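(* Let $\{B^\xi_\pm\}_{\xi\in\mathrm{ri}\,\mathcal U}$ be the cocycle family on $(\widehat\Omega,\widehat{\mathfrak S},\widehat{\mathbb P})$ described in the context. Fix $h\in\mathbb R^2$ and let $t(h)$, $\underline\xi(h)$, $\overline\xi(h)$ be as in the context. One has the following three cases. (i) $\underline\xi(h)\ne\overline\xi(h)$: for any (and hence all) $\xi\in\,]\underline\xi(h),\overline\xi(h)[$ let $$F^h(\widehat\omega,x,y)=h(\xi)\cdot(x-y)-B^\xi(\widehat\omega,x,y).\qquad(1)$$ Then for $\widehat{\mathbb P}$-almost every $\widehat\omega$ $$g_{\rm pl}(h)=\max_{i=1,2}\{\omega_0+h\cdot e_i+F^h(\widehat\omega,0,e_i)\}=t(h).\qquad(2)$$ (ii) $\underline\xi(h)=\overline\xi(h)=\xi\in\mathcal D$: (2) holds $\widehat{\mathbb P}$-a.s. for $F^h$ defined as in (1). (iii) $\underline\xi(h)=\overline\xi(h)=\xi\notin\mathcal D$: let $\theta\in[0,1]$ be such that $h-t(h)(e_1+e_2)=\theta h_-(\xi)+(1-\theta)h_+(\xi)$ and define $$F^{\xi\pm}(\widehat\omega,x,y)=h_\pm(\xi)\cdot(x-y)-B^\xi_\pm(\widehat\omega,x,y),\qquad F^h=\theta F^{\xi-}+(1-\theta)F^{\xi+}.$$ If $\theta\in\{0,1\}$, (2) holds again almost surely. For all $\theta\in[0,1]$ we have $$g_{\rm pl}(h)=\mathbb P\text{-}\operatorname*{ess\,sup}_{\omega}\max_{i=1,2}\{\omega_0+h\cdot e_i+\widehat{\mathbb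 E}[F^h(0,e_i)\,|\,\mathfrak S]\}=\widehat{\mathbb P}\text{-}\operatorname*{ess\,sup}_{\widehat\omega}\max_{i=1,2}\{\omega_0+h\cdot e_i+F^h(\widehat\omega,0,e_i)\}=t(h).$$ In particular, in all cases (i)–(iii), $\widehat{\mathbb E}[F^h(x,y)\,|\,\mathfrak S]\in\mathcal K_0(\Omega)$ is a minimizer in the variational formula $$g_{\rm pl}(h)=\inf_{F\in\mathcal K_0(\Omega)}\ \mathbb P\text{-}\operatorname*{ess\,sup}_\omega\ \max_{i\in\{1,2\}}\{\omega_0+h\cdot e_i+F(\omega,0,e_i)\}.$$
   Context: **Setting.** $\Omega=\mathbb R^{\mathbb Z^2}$ with Borel $\sigma$-algebra $\mathfrak S$, $\omega=(\omega_x)_{x\in\mathbb Z^2}$, translations $(T_x\omega)_y=\omega_{x+y}$. $\mathbb P$ is a probability measure on $\Omega$ under which $\{\omega_x\}$ are i.i.d., $\mathbb E[|\omega_0|^p]<\infty$ for some $p>2$, $\mathrm{Var}(\omega_0)>0$, $\mathbb P(\omega_0\ge c)=1$ for some $c>-\infty$. $m_0=\mathbb E[\omega_0]$. $e_1=(1,0)$, $e_2=(0,1)$, $|x|_1=|x\cdot e_1|+|x\cdot e_2|$, $x\le y$ coordinatewise. For $x\le y$ in $\mathbb Z^2$, $G_{x,y}=\max\sum_{k=0}^{n-1}\omega_{x_k}$ over up-right paths (increments in $\{e_1,e_2\}$) $x=x_0,\dots,x_n=y$. $G_n(h)=\max\{\sum_{k=0}^{n-1}\omega_{x_k}+h\cdot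 x_n\}$ over $n$-step up-right paths from $x_0=0$. The a.s. limits $g_{\rm pp}(\xi)=\lim_{n}n^{-1}G_{0,\lfloor n\xi\rfloor}$ ($\xi\in\mathbb R_+^2$) and $g_{\rm pl}(h)=\lim_n n^{-1}G_n(h)$ exist, nonrandom, finite; $g_{\rm pp}$ is continuous, concave, symmetric, $1$-homogeneous. $\mathrm{ri}\,\mathcal U=\{te_1+(1-t)e_2:0<t<1\}$. $\mathcal D$: points of $\mathrm{ri}\,\mathcal U$ where $g_{\rm pp}$ is differentiable. One-sided gradients: $\nabla g_{\rm pp}(\zeta\pm)\cdot e_1=\lim_{\varepsilon\searrow0}\frac{g_{\rm pp}(\zeta\pm\varepsilon e_1)-g_{\rm pp}(\zeta)}{\pm\varepsilon}$, $\nabla g_{\rm pp}(\zeta\pm)\cdot e_2=\lim_{\varepsilon\searrow0}\frac{g_{\rm pp}(\zeta\mp\varepsilon e_2)-g_{\rm pp}(\zeta)}{\mp\varepsilon}$. $[u,v]$, $]u,v[$ are closed/open line segments in $\mathbb R^2$. **Duality objects.** For each $h\in\mathbb R^2$ there is a unique $t=t(h)\in\mathbb R$ such that $h-t(e_1+e_2)\in-[\nabla g_{\rm pp}(\xi+),\nabla g_{\rm pp}(\xi-)]$ for some $\xi\in\mathrm{ri}\,\mathcal U$; the set of such $\xi$ is a nonempty closed, possibly degenerate, line segment $[\underline\xi(h),\overline\xi(h)]\subset\mathrm{ri}\,\mathcal U$, on which $g_{\rm pp}$ is linear. **Cocycles.** On a probability space with a translation action, a measurable real function $B(\cdot,x,y)$,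 $x,y\in\mathbb Z^2$, is a stationary $L^1$ cocycle if $B(0,e_1),B(0,e_2)$ are integrable and, almost surely for all $x,y,z$, $B(\cdot,z+x,z+y)=B(T_z\cdot,x,y)$ and $B(x,y)+B(y,z)=B(x,z)$. $\mathcal K(\Omega)$ is the space of these on $(\Omega,\mathfrak S,\mathbb P)$ and $\mathcal K_0(\Omega)$ the subspace with all means zero. $h(B)\in\mathbb R^2$ is defined by $E[B(0,e_i)]=-h(B)\cdot e_i$. The displayed variational formula for $g_{\rm pl}$ is a known identity. **Cocycle family.** $\widehat\Omega=\Omega\times\mathbb R^{\{1,2\}\times\mathcal A_0\times\mathbb Z^2}$, with $\mathcal A_0$ a certain countable subset of $(m_0,\infty)$; $\widehat\omega=(\omega,\omega')$; $\widehat{\mathfrak S}$ is the Borel $\sigma$-algebra; $\mathfrak S$ also denotes the sub-$\sigma$-algebra generated by $\widehat\omega\mapsto\omega$; translations $T_x$ shift all $\mathbb Z^2$-indexed coordinates. $\widehat{\mathbb P}$ is a translation invariant probability measure on $\widehat\Omega$ and $B^\xi_\pm(\widehat\omega,x,y)$ are real Borel functions of $(\widehat\omega,\xi,x,y)\in\widehat\Omega\times\mathrm{ri}\,\mathcal U\times\mathbb Z^2\times\mathbb Z^2$ such that: (1) the $\omega$-marginal of $\widehat{\mathbb P}$ is $\mathbb P$; for each $\xi,\pm$ the process $x\mapsto(\omega_x,B^\xi_\pm(x,x+e_1),B^\xi_\pm(x,x+e_2))$ is ergodic under $T_{e_1}$ and under $T_{e_2}$; for any $I\subset\mathbb Z^2$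 the variables $\{(\omega_x,B^\xi_+(x,x+e_i),B^\xi_-(x,x+e_i)):x\in I,\xi\in\mathrm{ri}\,\mathcal U,i\in\{1,2\}\}$ are independent of $\{\omega_x:x\not\ge z\ \forall z\in I\}$; (2) each $B^\xi_\pm$ is a stationary $L^1(\widehat{\mathbb P})$ cocycle, $\omega_x=B^\xi_\pm(x,x+e_1)\wedge B^\xi_\pm(x,x+e_2)$ $\widehat{\mathbb P}$-a.s., and $h_\pm(\xi):=h(B^\xi_\pm)=-\nabla g_{\rm pp}(\xi\pm)$; (3) cocycles of the family with equal $h$-vectors are identical for all $\widehat\omega$; in particular for $\xi\in\mathcal D$, $B^\xi_+=B^\xi_-=:B^\xi$ and $h_+(\xi)=h_-(\xi)=:h(\xi)$; (4) outside a single null set, for all $\xi,\zeta\in\mathrm{ri}\,\mathcal U$ with $\xi\cdot e_1<\zeta\cdot e_1$: $B^\xi_-(x,x+e_1)\ge B^\xi_+(x,x+e_1)\ge B^\zeta_-(x,x+e_1)$ and $B^\xi_-(x,x+e_2)\le B^\xi_+(x,x+e_2)\le B^\zeta_-(x,x+e_2)$; and $B^{\xi_n}_\pm(x,y)\to B^\zeta_+(x,y)$ whenever $\xi_n\cdot e_1\searrow\zeta\cdot e_1$, $\xi_n\ne\zeta$; (5) for each fixed $\zeta$, almost surely $B^{\xi_n}_\pm(x,y)\to B^\zeta_-(x,y)$ for every sequence $\xi_n\cdot e_1\nearrow\zeta\cdot e_1$, $\xi_n\neq\zeta$. Such a family exists. *)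

theory Defs
  imports "HOL-Probability.Probability" "HOL-Probability.Essential_Supremum"
    "HOL-Probability.Conditional_Expectation"
begin

section \<open>Lattice, environments and translations\<close>

type_synonym site = "int \<times> int"
type_synonym env = "site \<Rightarrow> real"
type_synonym aux = "nat \<times> real \<times> site \<Rightarrow> real"

text \<open>On pairs, \<open>\<le>\<close> is the coordinatewise order. The basis vector indices are \<open>1\<close> and \<open>2\<close>.\<close>

definition e :: "nat \<Rightarrow> site" where
  "e i = (if i = 1 then (1, 0) else (0, 1))"

definition rvec :: "site \<Rightarrow> real \<times> real" where
  "rvec x = (of_int (fst x), of_int (snd x))"

definition floor_vec :: "real \<times> real \<Rightarrow> site" where
  "floor_vec \<xi> = (\<lfloor>fst \<xi>\<rfloor>, \<lfloor>snd \<xi>\<rfloor>)"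

definition Omega :: "env measure" where
  "Omega = PiM UNIV (\<lambda>_. borel)"

text \<open>All index sets are countable, so the product sigma-algebras are the Borel ones.\<close>

definition Omega_hat :: "real set \<Rightarrow> (env \<times> aux) measure" where
  "Omega_hat A0 = Omega \<Otimes>\<^sub>M PiM ({1, 2} \<times> A0 \<times> UNIV) (\<lambda>_. borel)"

definition T :: "site \<Rightarrow> env \<Rightarrow> env" where
  "T z \<omega> = (\<lambda>x. \<omega> (z + x))"

definition T_hat :: "site \<Rightarrow> env \<times> aux \<Rightarrow> env \<times> aux" where
  "T_hat z w = (T z (fst w), \<lambda>(i, a, x). snd w (i, a, z + x))"


section \<open>Last-passage times and limit shapes\<close>

definition up_right :: "nat \<Rightarrow> (nat \<Rightarrow> site) \<Rightarrow> bool" where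
  "up_right n p \<longleftrightarrow> (\<forall>k<n. p (Suc k) - p k \<in> {e 1, e 2})"

definition G :: "env \<Rightarrow> site \<Rightarrow> site \<Rightarrow> real" where
  "G \<omega> x y = Max {\<Sum>k<n. \<omega> (p k) | n p. up_right n p \<and> p 0 = x \<and> p n = y}"

definition G_pl :: "env \<Rightarrow> real \<times> real \<Rightarrow> nat \<Rightarrow> real" where
  "G_pl \<omega> h n = Max {(\<Sum>k<n. \<omega> (p k)) + h \<bullet> rvec (p n) | p. up_right n p \<and> p 0 = 0}"

definition gpp :: "env measure \<Rightarrow> real \<times> real \<Rightarrow> real" where
  "gpp P \<xi> = (THE r. AE \<omega> in P. (\<lambda>n. G \<omega> 0 (floor_vec (real n *\<^sub>R \<xi>)) / real n) \<longlonglongrightarrow> r)"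

definition gpl :: "env measure \<Rightarrow> real \<times> real \<Rightarrow> real" where
  "gpl P h = (THE r. AE \<omega> in P. (\<lambda>n. G_pl \<omega> h n / real n) \<longlonglongrightarrow> r)"

definition riU :: "(real \<times> real) set" where
  "riU = {t *\<^sub>R rvec (e 1) + (1 - t) *\<^sub>R rvec (e 2) | t. 0 < t \<and> t < 1}"

definition diff_dirs :: "env measure \<Rightarrow> (real \<times> real) set" where
  "diff_dirs P = {\<xi> \<in> riU. gpp P differentiable (at \<xi>)}"

datatype side = Minus | Plus

text \<open>One-sided gradients: moving to the right along the simplex increases the first and decreases
  the second coordinate, hence the opposite signs in the two components.\<close>

fun sgn_of :: "side \<Rightarrow> real" where
  "sgn_of Plus = 1"
| "sgn_of Minus = -1"

definition grad :: "(real \<times> real \<Rightarrow> real) \<Rightarrow> side \<Rightarrow> real \<times> real \<Rightarrow> real \<times> real" where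
  "grad g s \<zeta> =
    (Lim (at_right 0) (\<lambda>\<epsilon>. (g (\<zeta> + (sgn_of s * \<epsilon>) *\<^sub>R rvec (e 1)) - g \<zeta>) / (sgn_of s * \<epsilon>)),
     Lim (at_right 0) (\<lambda>\<epsilon>. (g (\<zeta> - (sgn_of s * \<epsilon>) *\<^sub>R rvec (e 2)) - g \<zeta>) / (- (sgn_of s * \<epsilon>))))"

definition dual_dir :: "env measure \<Rightarrow> real \<times> real \<Rightarrow> real \<Rightarrow> real \<times> real \<Rightarrow> bool" where
  "dual_dir P h t \<xi> \<longleftrightarrow> \<xi> \<in> riU \<and>
     h - t *\<^sub>R (rvec (e 1) + rvec (e 2))
       \<in> uminus ` closed_segment (grad (gpp P) Plus \<xi>) (grad (gpp P) Minus \<xi>)"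

text \<open>\<open>t\<close>, \<open>\<xi>lo\<close>, \<open>\<xi>hi\<close> are the dual objects attached to \<open>h\<close>.\<close>

definition duality_data ::
  "env measure \<Rightarrow> real \<times> real \<Rightarrow> real \<Rightarrow> real \<times> real \<Rightarrow> real \<times> real \<Rightarrow> bool" where
  "duality_data P h t \<xi>lo \<xi>hi \<longleftrightarrow>
     (\<forall>s. (\<exists>\<xi>. dual_dir P h s \<xi>) \<longleftrightarrow> s = t) \<and>
     {\<xi>. dual_dir P h t \<xi>} = closed_segment \<xi>lo \<xi>hi \<and> fst \<xi>lo \<le> fst \<xi>hi"


section \<open>Stationary cocycles\<close>

type_synonym 'w cocycle = "'w \<Rightarrow> site \<Rightarrow> site \<Rightarrow> real"

definition stat_cocycle :: "'w measure \<Rightarrow> (site \<Rightarrow> 'w \<Rightarrow> 'w) \<Rightarrow> 'w cocycle \<Rightarrow> bool" where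
  "stat_cocycle M \<tau> B \<longleftrightarrow>
     (\<forall>x y. (\<lambda>w. B w x y) \<in> borel_measurable M) \<and>
     (\<forall>i\<in>{1, 2}. integrable M (\<lambda>w. B w 0 (e i))) \<and>
     (AE w in M. \<forall>x y z. B w (z + x) (z + y) = B (\<tau> z w) x y \<and> B w x y + B w y z = B w x z)"

definition K :: "env measure \<Rightarrow> env cocycle set" where
  "K P = {B. stat_cocycle P T B}"

definition K0 :: "env measure \<Rightarrow> env cocycle set" where
  "K0 P = {B \<in> K P. \<forall>x y. (\<integral>\<omega>. B \<omega> x y \<partial>P) = 0}"

definition hvec :: "'w measure \<Rightarrow> 'w cocycle \<Rightarrow> real \<times> real" where
  "hvec M B = (- (\<integral>w. B w 0 (e 1) \<partial>M), - (\<integral>w. B w 0 (e 2) \<partial>M))"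

definition centered :: "'w measure \<Rightarrow> 'w cocycle \<Rightarrow> 'w cocycle" where
  "centered M B = (\<lambda>w x y. hvec M B \<bullet> rvec (x - y) - B w x y)"

definition ergodic_under :: "'a measure \<Rightarrow> ('a \<Rightarrow> 'a) \<Rightarrow> bool" where
  "ergodic_under M \<tau> \<longleftrightarrow> \<tau> \<in> measurable M M \<and> distr M M \<tau> = M \<and>
     (\<forall>A\<in>sets M. \<tau> -` A \<inter> space M = A \<longrightarrow> measure M A \<in> {0, 1})"

text \<open>Ergodicity of a process means ergodicity of its law under the shift of path space.\<close>

definition ergodic_process ::
  "'w measure \<Rightarrow> ('w \<Rightarrow> site \<Rightarrow> real \<times> real \<times> real) \<Rightarrow> site \<Rightarrow> bool" where
  "ergodic_process M X z \<longleftrightarrow>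
     ergodic_under (distr M (PiM UNIV (\<lambda>_. borel)) X) (\<lambda>\<eta> x. \<eta> (z + x))"


section \<open>The model and the cocycle family\<close>

locale corner_growth = prob_space P for P :: "env measure" +
  assumes sets_P: "sets P = sets Omega"
    and indep: "indep_vars (\<lambda>_. borel) (\<lambda>x \<omega>. \<omega> x) UNIV"
    and ident: "\<And>x. distr P borel (\<lambda>\<omega>. \<omega> x) = distr P borel (\<lambda>\<omega>. \<omega> 0)"
    and moment: "\<exists>p>2. integrable P (\<lambda>\<omega>. \<bar>\<omega> 0\<bar> powr p)"
    and variance_pos: "variance (\<lambda>\<omega>. \<omega> 0) > 0"
    and bounded_below: "\<exists>c. AE \<omega> in P. c \<le> \<omega> 0"

text \<open>Known facts about the limit shapes that are presupposed: existence of the nonrandom finite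
  limits, and regularity of \<open>gpp\<close> on the closed quadrant.\<close>

locale corner_growth_limits = corner_growth P for P :: "env measure" +
  assumes pp_limit: "\<And>\<xi>. 0 \<le> \<xi> \<Longrightarrow>
      \<exists>r. AE \<omega> in P. (\<lambda>n. G \<omega> 0 (floor_vec (real n *\<^sub>R \<xi>)) / real n) \<longlonglongrightarrow> r"
    and pl_limit: "\<And>h. \<exists>r. AE \<omega> in P. (\<lambda>n. G_pl \<omega> h n / real n) \<longlonglongrightarrow> r"
    and gpp_continuous: "continuous_on {\<xi>. 0 \<le> \<xi>} (gpp P)"
    and gpp_concave: "concave_on {\<xi>. 0 \<le> \<xi>} (gpp P)"
    and gpp_symmetric: "\<And>a b. 0 \<le> a \<Longrightarrow> 0 \<le> b \<Longrightarrow> gpp P (a, b) = gpp P (b, a)"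
    and gpp_homogeneous: "\<And>c \<xi>. 0 \<le> c \<Longrightarrow> 0 \<le> \<xi> \<Longrightarrow> gpp P (c *\<^sub>R \<xi>) = c * gpp P \<xi>"

text \<open>The independence in \<open>indep_past\<close> is that of the generated sigma-algebras; these are written
  out with \<open>sigma_sets\<close> because the first family of variables is uncountable.\<close>

locale cocycle_family = corner_growth_limits P + hat: prob_space Ph
  for P :: "env measure" and Ph :: "(env \<times> aux) measure" +
  fixes A0 :: "real set"
    and B :: "side \<Rightarrow> real \<times> real \<Rightarrow> (env \<times> aux) cocycle"
  assumes A0: "countable A0" "A0 \<subseteq> {expectation (\<lambda>\<omega>. \<omega> 0)<..}"
    and sets_Ph: "sets Ph = sets (Omega_hat A0)"
    and invariant: "\<And>z. distr Ph Ph (T_hat z) = Ph"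
    and B_borel: "\<And>s. (\<lambda>(w, \<xi>, x, y). B s \<xi> w x y) \<in> borel_measurable
        (Ph \<Otimes>\<^sub>M restrict_space borel riU \<Otimes>\<^sub>M count_space UNIV \<Otimes>\<^sub>M count_space UNIV)"
    and marginal: "distr Ph P fst = P"
    and ergodic: "\<And>s \<xi> i. \<xi> \<in> riU \<Longrightarrow> i \<in> {1, 2} \<Longrightarrow>
        ergodic_process Ph (\<lambda>w x. (fst w x, B s \<xi> w x (x + e 1), B s \<xi> w x (x + e 2))) (e i)"
    and indep_past: "\<And>I. hat.indep_set
        (sigma_sets (space Ph)
          {(\<lambda>w. (fst w x, B Plus \<xi> w x (x + e i), B Minus \<xi> w x (x + e i))) -` A \<inter> space Ph | x \<xi> i A.
             x \<in> I \<and> \<xi> \<in> riU \<and> i \<in> {1, 2} \<and> A \<in> sets borel})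
        (sigma_sets (space Ph)
          {(\<lambda>w. fst w x) -` A \<inter> space Ph | x A. (\<forall>z\<in>I. \<not> z \<le> x) \<and> A \<in> sets borel})"
    and cocycle: "\<And>s \<xi>. \<xi> \<in> riU \<Longrightarrow> stat_cocycle Ph T_hat (B s \<xi>)"
    and recovery: "\<And>s \<xi>. \<xi> \<in> riU \<Longrightarrow>
        AE w in Ph. \<forall>x. fst w x = min (B s \<xi> w x (x + e 1)) (B s \<xi> w x (x + e 2))"
    and mean: "\<And>s \<xi>. \<xi> \<in> riU \<Longrightarrow> hvec Ph (B s \<xi>) = - grad (gpp P) s \<xi>"
    and equal_h: "\<And>s s' \<xi> \<xi>' w x y. \<xi> \<in> riU \<Longrightarrow> \<xi>' \<in> riU \<Longrightarrow>
        hvec Ph (B s \<xi>) = hvec Ph (B s' \<xi>') \<Longrightarrow> w \<in> space Ph \<Longrightarrow> B s \<xi> w x y = B s' \<xi>' w x y"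
    and monotone_right_cont: "AE w in Ph.
        (\<forall>\<xi>\<in>riU. \<forall>\<zeta>\<in>riU. fst \<xi> < fst \<zeta> \<longrightarrow> (\<forall>x.
            B Minus \<xi> w x (x + e 1) \<ge> B Plus \<xi> w x (x + e 1) \<and>
            B Plus \<xi> w x (x + e 1) \<ge> B Minus \<zeta> w x (x + e 1) \<and>
            B Minus \<xi> w x (x + e 2) \<le> B Plus \<xi> w x (x + e 2) \<and>
            B Plus \<xi> w x (x + e 2) \<le> B Minus \<zeta> w x (x + e 2))) \<and>
        (\<forall>\<zeta>\<in>riU. \<forall>\<xi>. (\<forall>n. \<xi> n \<in> riU \<and> \<xi> n \<noteq> \<zeta>) \<and> decseq (\<lambda>n. fst (\<xi> n)) \<and>
            (\<lambda>n. fst (\<xi> n)) \<longlonglongrightarrow> fst \<zeta> \<longrightarrow>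
            (\<forall>s x y. (\<lambda>n. B s (\<xi> n) w x y) \<longlonglongrightarrow> B Plus \<zeta> w x y))"
    and left_cont: "\<And>\<zeta>. \<zeta> \<in> riU \<Longrightarrow> AE w in Ph.
        \<forall>\<xi>. (\<forall>n. \<xi> n \<in> riU \<and> \<xi> n \<noteq> \<zeta>) \<and> incseq (\<lambda>n. fst (\<xi> n)) \<and>
            (\<lambda>n. fst (\<xi> n)) \<longlonglongrightarrow> fst \<zeta> \<longrightarrow>
            (\<forall>s x y. (\<lambda>n. B s (\<xi> n) w x y) \<longlonglongrightarrow> B Minus \<zeta> w x y)"


section \<open>The variational formula\<close>

definition step_max :: "real \<times> real \<Rightarrow> env \<Rightarrow> (site \<Rightarrow> site \<Rightarrow> real) \<Rightarrow> real" where
  "step_max h \<omega> F = Max ((\<lambda>i. \<omega> 0 + h \<bullet> rvec (e i) + F 0 (e i)) ` {1, 2})"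

definition ess_step :: "env measure \<Rightarrow> real \<times> real \<Rightarrow> env cocycle \<Rightarrow> ereal" where
  "ess_step P h F = esssup P (\<lambda>\<omega>. ereal (step_max h \<omega> (F \<omega>)))"

definition ess_step_hat ::
  "(env \<times> aux) measure \<Rightarrow> real \<times> real \<Rightarrow> (env \<times> aux) cocycle \<Rightarrow> ereal" where
  "ess_step_hat Ph h F = esssup Ph (\<lambda>w. ereal (step_max h (fst w) (F w)))"

definition env_algebra :: "env measure \<Rightarrow> (env \<times> aux) measure \<Rightarrow> (env \<times> aux) measure" where
  "env_algebra P Ph = vimage_algebra (space Ph) fst P"

text \<open>\<open>C\<close> is a version of the conditional expectation of \<open>F\<close> given the environment, viewed as a
  function on the environment space.\<close>

definition cond_version ::
  "env measure \<Rightarrow> (env \<times> aux) measure \<Rightarrow> (env \<times> aux) cocycle \<Rightarrow> env cocycle \<Rightarrow> bool" where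
  "cond_version P Ph F C \<longleftrightarrow> (\<forall>x y. (\<lambda>\<omega>. C \<omega> x y) \<in> borel_measurable P \<and>
     (AE w in Ph. C (fst w) x y = real_cond_exp Ph (env_algebra P Ph) (\<lambda>w. F w x y) w))"

definition constant_ae ::
  "env measure \<Rightarrow> (env \<times> aux) measure \<Rightarrow> real \<times> real \<Rightarrow> real \<Rightarrow> (env \<times> aux) cocycle \<Rightarrow> bool" where
  "constant_ae P Ph h t F \<longleftrightarrow>
     (AE w in Ph. gpl P h = step_max h (fst w) (F w) \<and> step_max h (fst w) (F w) = t)"

text \<open>A version exists, and every version is a minimizer of the variational formula, the formula
  itself being part of the claim.\<close>

definition cond_exp_minimizes ::
  "env measure \<Rightarrow> (env \<times> aux) measure \<Rightarrow> real \<times> real \<Rightarrow> (env \<times> aux) cocycle \<Rightarrow> bool" where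
  "cond_exp_minimizes P Ph h F \<longleftrightarrow>
     (\<exists>C. cond_version P Ph F C) \<and>
     (\<forall>C. cond_version P Ph F C \<longrightarrow> C \<in> K0 P \<and> ess_step P h C = (INF F'\<in>K0 P. ess_step P h F')) \<and>
     ereal (gpl P h) = (INF F'\<in>K0 P. ess_step P h F')"

definition mix :: "real \<Rightarrow> 'w cocycle \<Rightarrow> 'w cocycle \<Rightarrow> 'w cocycle" where
  "mix \<theta> F F' = (\<lambda>w x y. \<theta> * F w x y + (1 - \<theta>) * F' w x y)"

end

theory Submission
  imports Defs
begin

text \<open>
  Write \<open>g\<close> for the point-to-point limit shape \<open>gpp P\<close>. The proof rests on three facts.

  Convex duality. One-sided gradients of a concave \<open>1\<close>-homogeneous function are supergradients,
  and they satisfy Euler's identity. Hence a dual direction \<open>\<xi>\<close> of \<open>h\<close>, with its number \<open>t\<close>, satisfies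
  \<open>g \<xi> + h \<bullet> \<xi> = t\<close>, while \<open>g \<zeta> + h \<bullet> \<zeta> \<le> t (\<zeta>\<^sub>1 + \<zeta>\<^sub>2)\<close> in the open quadrant
  (\<open>dual_dir_supporting_line\<close>). The weights are bounded below, so passage times are monotone
  in the endpoint up to an error linear in the distance, and finitely many directions control all the
  paths of \<open>n\<close> steps. This gives \<open>gpl P h = t\<close> (\<open>gpl_eq_dual\<close>).

  The lower bound. If the local maxima of a centered cocycle \<open>F\<close> on the environment space are at
  most \<open>r\<close>, then summing along a path gives \<open>G 0 x + h \<bullet> x + F 0 x \<le> |x|\<^sub>1 r\<close>. The mean of
  \<open>F 0 x\<close> is zero, so taking expectations along \<open>x = \<lfloor>n \<xi>\<rfloor>\<close> and using Fatou's lemma yields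
  \<open>t = g \<xi> + h \<bullet> \<xi> \<le> r\<close> (\<open>gpp_le_step_bound\<close>).

  The upper bound. For the centered cocycle of the family the local terms are
  \<open>\<omega>\<^sub>0 + h \<bullet> e\<^sub>i + F 0 e\<^sub>i = t + \<omega>\<^sub>0 - B 0 e\<^sub>i\<close> when \<open>h - t (e\<^sub>1 + e\<^sub>2)\<close> is the vector of
  the cocycle \<open>B\<close>; their maximum is \<open>t\<close> because \<open>\<omega>\<^sub>0\<close> is the minimum of the two \<open>B 0 e\<^sub>i\<close>.
  For a convex combination of the two one-sided cocycles only \<open>\<le>\<close> survives
  (\<open>mix_step_bound\<close>). The conditional expectation given the environment is again a centered
  cocycle (\<open>cond_version_in_K0\<close>) and inherits the bound \<open>t\<close>, so it meets the lower bound and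
  is a minimizer (\<open>cond_exp_minimizer\<close>).

  When the dual directions fill a nondegenerate segment, \<open>g\<close> is linear on the cone over it, hence
  differentiable inside, and the two one-sided gradients coincide there
  (\<open>gpp_linear_near_flat_segment\<close>).
\<close>

section \<open>One-sided gradients of concave homogeneous functions\<close>

text \<open>The difference quotients increase as the increment shrinks, and the slopes to the left of \<open>s\<close>
  bound them; the supporting line on the left comes from the same comparison.\<close>

lemma concave_right_derivative:
  fixes k :: "real \<Rightarrow> real"
  assumes k: "concave_on {0..} k" and s: "0 < s"
  obtains D where "((\<lambda>\<epsilon>. (k (s + \<epsilon>) - k s) / \<epsilon>) \<longlongrightarrow> D) (at_right 0)"
    and "\<And>x. 0 \<le> x \<Longrightarrow> k x \<le> k s + D * (x - s)"
proof -
  define q where "q = (\<lambda>\<epsilon>. (k (s + \<epsilon>) - k s) / \<epsilon>)"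
  have conv: "convex_on {0..} (\<lambda>x. - k x)"
    using k by (simp add: concave_on_def)
  have mono: "q b \<le> q a" if "0 < a" "a \<le> b" for a b
  proof (cases "a = b")
    case False
    with convex_on_slope_le(1)[OF conv, of s "s + b" "s + a"] that s
    show ?thesis by (simp add: q_def field_simps)
  qed simp
  have left: "q \<epsilon> \<le> (k s - k x) / (s - x)" if "0 < \<epsilon>" "0 \<le> x" "x < s" for \<epsilon> x
  proof -
    have "(- k x - - k s) / (x - s) \<le> (- k s - - k (s + \<epsilon>)) / (s - (s + \<epsilon>))"
      using convex_on_slope_le[OF conv, of x "s + \<epsilon>" s] that s by auto
    moreover have "(- k x - - k s) / (x - s) = - ((k s - k x) / (s - x))"
      using that by (simp add: divide_simps) (simp add: algebra_simps)
    ultimately show ?thesis by (simp add: q_def)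
  qed
  define D where "D = - Inf ((\<lambda>\<epsilon>. - q \<epsilon>) ` ({0<..} \<inter> UNIV))"
  have lim: "((\<lambda>\<epsilon>. - q \<epsilon>) \<longlongrightarrow> - D) (at 0 within ({0<..} \<inter> UNIV))"
    unfolding D_def minus_minus
    by (rule Lim_right_bound[where K = "- ((k s - k 0) / (s - 0))"])
      (use mono left[of _ 0] s in auto)
  then have lim: "(q \<longlongrightarrow> D) (at_right 0)"
    using tendsto_minus_cancel[of q D] by simp
  have "k x \<le> k s + D * (x - s)" if "0 \<le> x" for x
  proof (cases x s rule: linorder_cases)
    case less
    have "D \<le> (k s - k x) / (s - x)"
      using less that
      by (intro tendsto_upperbound[OF lim]) (auto simp: eventually_at_right_field intro!: left exI[of _ 1])
    with less show ?thesis by (simp add: field_simps)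
  next
    case greater
    have "Inf ((\<lambda>\<epsilon>. - q \<epsilon>) ` ({0<..} \<inter> UNIV)) \<le> - q (x - s)"
      using greater left[of _ 0] s
      by (intro cInf_lower) (auto intro!: bdd_belowI[of _ "- ((k s - k 0) / (s - 0))"])
    then have "q (x - s) \<le> D" by (simp add: D_def)
    with greater show ?thesis by (simp add: q_def field_simps)
  qed simp
  with lim show ?thesis using that by (simp add: q_def)
qed

lemma rvec_e [simp]: "rvec (e (Suc 0)) = (1, 0)" "rvec (e 2) = (0, 1)"
  by (simp_all add: rvec_def e_def)

lemma riU_iff: "\<xi> \<in> riU \<longleftrightarrow> 0 < fst \<xi> \<and> 0 < snd \<xi> \<and> fst \<xi> + snd \<xi> = 1"
  by (cases \<xi>) (auto simp: riU_def intro!: exI[of _ "fst \<xi>"])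

text \<open>The second component of the gradient is determined by the first: by homogeneity a step against
  \<open>e\<^sub>2\<close> is, up to scaling, a step along \<open>e\<^sub>1\<close>. This yields Euler's identity, and
  homogeneity spreads the one-dimensional supporting line on a horizontal ray to the whole open
  quadrant.\<close>

lemma grad_Plus_supergradient:
  fixes g :: "real \<times> real \<Rightarrow> real"
  assumes conc: "concave_on {\<xi>. 0 \<le> \<xi>} g"
    and hom: "\<And>c \<xi>. 0 \<le> c \<Longrightarrow> 0 \<le> \<xi> \<Longrightarrow> g (c *\<^sub>R \<xi>) = c * g \<xi>"
    and \<xi>: "\<xi> \<in> riU"
  shows "grad g Plus \<xi> \<bullet> \<xi> = g \<xi>"
    and "\<And>\<zeta>. 0 < fst \<zeta> \<Longrightarrow> 0 < snd \<zeta> \<Longrightarrow> g \<zeta> \<le> grad g Plus \<xi> \<bullet> \<zeta>"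
proof -
  define s where "s = fst \<xi>"
  have s: "0 < s" "s < 1" and \<xi>s: "\<xi> = (s, 1 - s)"
    using \<xi> by (auto simp: riU_iff s_def prod_eq_iff)
  define k where "k = (\<lambda>x. g (x, 1 - s))"
  have "concave_on {0..} k"
  proof (subst concave_on_iff, intro conjI ballI allI impI)
    fix x y u v :: real
    assume a: "x \<in> {0..}" "y \<in> {0..}" "0 \<le> u" "0 \<le> v" "u + v = 1"
    have "u * (1 - s) + v * (1 - s) = 1 - s"
      using a by (simp flip: distrib_right)
    moreover have "g (u *\<^sub>R (x, 1 - s) + v *\<^sub>R (y, 1 - s)) \<ge> u * g (x, 1 - s) + v * g (y, 1 - s)"
      using conc a s unfolding concave_on_iff by (auto simp: less_eq_prod_def)
    ultimately show "u * k x + v * k y \<le> k (u *\<^sub>R x + v *\<^sub>R y)"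
      by (simp add: k_def)
  qed simp
  then obtain D where D: "((\<lambda>\<epsilon>. (k (s + \<epsilon>) - k s) / \<epsilon>) \<longlongrightarrow> D) (at_right 0)"
    and le: "\<And>x. 0 \<le> x \<Longrightarrow> k x \<le> k s + D * (x - s)"
    using concave_right_derivative s(1) by blast
  define E where "E = (g \<xi> - s * D) / (1 - s)"
  \<comment> \<open>By homogeneity the points \<open>\<xi> - \<epsilon> e\<^sub>2\<close> and \<open>\<xi> + \<delta>(\<epsilon>) e\<^sub>1\<close> lie on one ray.\<close>
  define \<delta> where "\<delta> = (\<lambda>\<epsilon>. s * \<epsilon> / (1 - s - \<epsilon>))"
  have small: "\<forall>\<^sub>F \<epsilon> in at_right 0. 0 < \<epsilon> \<and> \<epsilon> < 1 - s"
    using s by (auto simp: eventually_at_right_field intro!: exI[of _ "1 - s"])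
  have "(\<delta> \<longlongrightarrow> 0) (at_right 0)"
    unfolding \<delta>_def using s by (auto intro!: tendsto_eq_intros)
  moreover have "\<forall>\<^sub>F \<epsilon> in at_right 0. \<delta> \<epsilon> \<in> {0<..} \<and> \<delta> \<epsilon> \<noteq> 0"
    using small by eventually_elim (use s in \<open>auto simp: \<delta>_def\<close>)
  ultimately have "filterlim \<delta> (at_right 0) (at_right 0)"
    by (simp add: filterlim_at)
  from filterlim_compose[OF D this]
  have "((\<lambda>\<epsilon>. g \<xi> / (1 - s) - s / (1 - s) * ((k (s + \<delta> \<epsilon>) - k s) / \<delta> \<epsilon>)) \<longlongrightarrow>
      g \<xi> / (1 - s) - s / (1 - s) * D) (at_right 0)"
    by (intro tendsto_intros)
  moreover have "\<forall>\<^sub>F \<epsilon> in at_right 0. g \<xi> / (1 - s) - s / (1 - s) * ((k (s + \<delta> \<epsilon>) - k s) / \<delta> \<epsilon>)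
      = (g (\<xi> - (1 * \<epsilon>) *\<^sub>R rvec (e 2)) - g \<xi>) / (- (1 * \<epsilon>))"
    using small
  proof eventually_elim
    case (elim \<epsilon>)
    define c where "c = (1 - s - \<epsilon>) / (1 - s)"
    have nz: "1 - s \<noteq> 0" "1 - s - \<epsilon> \<noteq> 0"
      using elim s by auto
    then have c: "0 < c" "c * \<delta> \<epsilon> = s * \<epsilon> / (1 - s)" and d: "0 < \<delta> \<epsilon>"
      using elim s by (simp_all add: c_def \<delta>_def)
    have c': "c = 1 - \<epsilon> / (1 - s)"
      using nz by (simp add: c_def diff_divide_distrib[of "1 - s"])
    have "\<xi> - (1 * \<epsilon>) *\<^sub>R rvec (e 2) = c *\<^sub>R (s + \<delta> \<epsilon>, 1 - s)"
    proof -
      have "c * (s + \<delta> \<epsilon>) = s"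
        unfolding distrib_left c(2) by (simp add: c' algebra_simps)
      moreover have "c * (1 - s) = 1 - s - \<epsilon>" using nz by (simp add: c_def)
      ultimately show ?thesis by (simp add: \<xi>s)
    qed
    then have "g (\<xi> - (1 * \<epsilon>) *\<^sub>R rvec (e 2)) = c * k (s + \<delta> \<epsilon>)"
      using hom[of c "(s + \<delta> \<epsilon>, 1 - s)"] c d s by (simp add: k_def less_eq_prod_def)
    moreover have "k s = g \<xi>" by (simp add: k_def \<xi>s)
    moreover have "s / (1 - s) / \<delta> \<epsilon> = c / \<epsilon>"
    proof -
      have "s / (1 - s) = c * \<delta> \<epsilon> / \<epsilon>" using elim by (simp add: c(2))
      then show ?thesis using d by simp
    qed
    moreover have "c * g \<xi> / \<epsilon> = g \<xi> / \<epsilon> - g \<xi> / (1 - s)"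
    proof -
      have "c / \<epsilon> = 1 / \<epsilon> - 1 / (1 - s)"
        unfolding c' diff_divide_distrib[of _ _ \<epsilon>] using elim by simp
      then have "c / \<epsilon> * g \<xi> = 1 / \<epsilon> * g \<xi> - 1 / (1 - s) * g \<xi>"
        by (simp only: left_diff_distrib)
      then show ?thesis by simp
    qed
    ultimately show ?case
      unfolding times_divide_eq_right times_divide_eq_left[symmetric]
      by (simp add: right_diff_distrib diff_divide_distrib)
  qed
  ultimately have E: "((\<lambda>\<epsilon>. (g (\<xi> - (1 * \<epsilon>) *\<^sub>R rvec (e 2)) - g \<xi>) / (- (1 * \<epsilon>))) \<longlongrightarrow> E) (at_right 0)"
    by (rule Lim_transform_eventually[THEN tendsto_eq_rhs]) (simp add: E_def diff_divide_distrib)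
  have D': "((\<lambda>\<epsilon>. (g (\<xi> + (1 * \<epsilon>) *\<^sub>R rvec (e 1)) - g \<xi>) / (1 * \<epsilon>)) \<longlongrightarrow> D) (at_right 0)"
    using D by (simp add: k_def \<xi>s)
  have grad: "grad g Plus \<xi> = (D, E)"
    unfolding grad_def sgn_of.simps using D' E by (auto intro!: tendsto_Lim)
  have sE: "s * D + (1 - s) * E = g \<xi>"
    using s by (simp add: E_def)
  then show "grad g Plus \<xi> \<bullet> \<xi> = g \<xi>"
    by (simp add: grad) (simp add: \<xi>s inner_prod_def algebra_simps)
  fix \<zeta> :: "real \<times> real" assume z: "0 < fst \<zeta>" "0 < snd \<zeta>"
  define c where "c = snd \<zeta> / (1 - s)"
  have c: "0 < c" "snd \<zeta> = c * (1 - s)" using z s by (auto simp: c_def)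
  have "\<zeta> = c *\<^sub>R (fst \<zeta> / c, 1 - s)"
    using c by (auto simp: prod_eq_iff)
  then have "g \<zeta> = c * k (fst \<zeta> / c)"
    using hom[of c "(fst \<zeta> / c, 1 - s)"] c z s by (simp add: k_def less_eq_prod_def)
  also have "\<dots> \<le> c * (k s + D * (fst \<zeta> / c - s))"
    using c z by (intro mult_left_mono le) auto
  also have "k s = s * D + (1 - s) * E" using sE by (simp add: k_def \<xi>s)
  also have "c * (s * D + (1 - s) * E + D * (fst \<zeta> / c - s)) = D * fst \<zeta> + E * snd \<zeta>"
    using c by (simp add: c(2) field_simps)
  finally show "g \<zeta> \<le> grad g Plus \<xi> \<bullet> \<zeta>"
    by (simp add: grad inner_prod_def)
qed

text \<open>Reflecting in the diagonal exchanges the two sides, so for a symmetric function the properties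
  of the \<open>Minus\<close> gradient follow from those of the \<open>Plus\<close> gradient.\<close>

lemma grad_Minus_eq_swap:
  fixes g :: "real \<times> real \<Rightarrow> real"
  assumes sym: "\<And>a b. 0 \<le> a \<Longrightarrow> 0 \<le> b \<Longrightarrow> g (a, b) = g (b, a)" and \<xi>: "\<xi> \<in> riU"
  shows "grad g Minus \<xi> = prod.swap (grad g Plus (prod.swap \<xi>))"
proof -
  obtain a b where ab: "\<xi> = (a, b)" "0 < a" "0 < b" using \<xi> by (cases \<xi>) (auto simp: riU_iff)
  have *: "Lim (at_right 0) f = Lim (at_right 0) f'"
    if "\<And>\<epsilon>. 0 < \<epsilon> \<Longrightarrow> \<epsilon> < min a b \<Longrightarrow> f \<epsilon> = f' \<epsilon>" for f f' :: "real \<Rightarrow> real"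
  proof -
    have "\<forall>\<^sub>F \<epsilon> in at_right 0. f \<epsilon> = f' \<epsilon>"
      using ab that by (auto simp: eventually_at_right_field intro!: exI[of _ "min a b"])
    then have "(f \<longlongrightarrow> l) (at_right 0) \<longleftrightarrow> (f' \<longlongrightarrow> l) (at_right 0)" for l
      by (rule tendsto_cong)
    then show ?thesis
      by (simp add: Topological_Spaces.Lim_def)
  qed
  show ?thesis
  proof (rule prod_eqI)
    show "fst (grad g Minus \<xi>) = fst (prod.swap (grad g Plus (prod.swap \<xi>)))"
      unfolding grad_def ab sgn_of.simps fst_conv snd_conv swap_simp
      by (rule *) (use sym[of "a - _" b] sym[of a b] ab in auto)
    show "snd (grad g Minus \<xi>) = snd (prod.swap (grad g Plus (prod.swap \<xi>)))"
      unfolding grad_def ab sgn_of.simps fst_conv snd_conv swap_simp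
      by (rule *) (use sym[of a "b + _"] sym[of a b] ab in auto)
  qed
qed

lemma grad_eq_if_has_derivative:
  fixes g :: "real \<times> real \<Rightarrow> real"
  assumes g: "(g has_derivative (\<lambda>u. v \<bullet> u)) (at \<xi>)"
  shows "grad g s \<xi> = v"
proof -
  have dir: "((\<lambda>\<epsilon>. (g (\<xi> + (k * \<epsilon>) *\<^sub>R u) - g \<xi>) / (k * \<epsilon>)) \<longlongrightarrow> v \<bullet> u) (at_right 0)"
    if k: "k \<noteq> 0" for k :: real and u
  proof -
    have "((\<lambda>x. g (\<xi> + x *\<^sub>R u)) has_derivative (\<lambda>x. v \<bullet> (x *\<^sub>R u))) (at 0)"
      by (rule has_derivative_compose[where g = g and f = "\<lambda>x. \<xi> + x *\<^sub>R u"])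
        (use g in \<open>auto intro!: derivative_eq_intros\<close>)
    then have "((\<lambda>x. g (\<xi> + x *\<^sub>R u)) has_field_derivative (v \<bullet> u)) (at 0)"
      by (simp add: has_field_derivative_def mult_commute_abs)
    then have "((\<lambda>x. (g (\<xi> + x *\<^sub>R u) - g \<xi>) / x) \<longlongrightarrow> v \<bullet> u) (at 0)"
      by (simp add: DERIV_def)
    moreover have "filterlim (\<lambda>\<epsilon>. k * \<epsilon>) (at 0) (at_right 0)"
      using k by (auto simp: filterlim_at eventually_at_filter intro!: tendsto_eq_intros)
    ultimately show ?thesis by (rule filterlim_compose)
  qed
  have s: "sgn_of s \<noteq> 0" by (cases s) auto
  have "grad g s \<xi> = (v \<bullet> rvec (e 1), v \<bullet> rvec (e 2))"
    unfolding grad_def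
    using tendsto_Lim[OF _ dir[of "sgn_of s" "rvec (e 1)"]]
      tendsto_Lim[OF _ dir[of "- sgn_of s" "rvec (e 2)"]] s
    by (simp del: rvec_e)
  then show ?thesis by (cases v) simp
qed

section \<open>Up-right paths\<close>

definition level :: "site \<Rightarrow> int" where
  "level x = fst x + snd x"

lemma up_right_le: "up_right n p \<Longrightarrow> k \<le> n \<Longrightarrow> up_right k p"
  by (simp add: up_right_def)

lemma up_right_Suc: "up_right (Suc n) p \<longleftrightarrow> up_right n p \<and> (p (Suc n) = p n + e 1 \<or> p (Suc n) = p n + e 2)"
  by (auto simp: up_right_def less_Suc_eq algebra_simps)

lemma up_right_level: "up_right n p \<Longrightarrow> level (p n) = level (p 0) + int n"
  by (induction n) (auto simp: up_right_Suc level_def e_def)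

lemma up_right_start_le: "up_right n p \<Longrightarrow> p 0 \<le> p n"
  by (induction n) (auto simp: up_right_Suc less_eq_prod_def e_def)

text \<open>A path is a function on all of \<open>nat\<close>, but only its first \<open>n + 1\<close> values matter, and those
  lie in a finite box. This makes the maxima over paths genuine maxima.\<close>

lemma finite_path_values:
  assumes F: "\<And>p q. (\<And>k. k \<le> n \<Longrightarrow> p k = q k) \<Longrightarrow> F p = F q"
  shows "finite {F p | p. up_right n p \<and> p 0 = x \<and> Q p}"
proof (rule finite_subset)
  let ?box = "{fst x..fst x + int n} \<times> {snd x..snd x + int n}"
  show "finite (F ` ({..n} \<rightarrow>\<^sub>E ?box))"
    by (intro finite_imageI finite_PiE) auto
  show "{F p | p. up_right n p \<and> p 0 = x \<and> Q p} \<subseteq> F ` ({..n} \<rightarrow>\<^sub>E ?box)"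
  proof safe
    fix p assume p: "up_right n p" "x = p 0"
    have "p k \<in> ?box" if "k \<le> n" for k
      using up_right_level[OF up_right_le[OF p(1) that]] up_right_start_le[OF up_right_le[OF p(1) that]] that p
      by (auto simp: level_def less_eq_prod_def mem_Times_iff)
    then have "restrict p {..n} \<in> {..n} \<rightarrow>\<^sub>E ?box" by (auto simp: p(2))
    moreover have "F p = F (restrict p {..n})" by (rule F) simp
    ultimately show "F p \<in> F ` ({..n} \<rightarrow>\<^sub>E {fst (p 0)..fst (p 0) + int n} \<times> {snd (p 0)..snd (p 0) + int n})"
      by (simp add: p(2))
  qed
qed

lemma finite_G_values: "finite {\<Sum>k<n. \<omega> (p k) | n p. up_right n p \<and> p 0 = x \<and> p n = y}"
  for \<omega> :: env
proof -
  let ?n = "nat (level y - level x)"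
  have "{\<Sum>k<n. \<omega> (p k) | n p. up_right n p \<and> p 0 = x \<and> p n = y}
      \<subseteq> {\<Sum>k<?n. \<omega> (p k) | p. up_right ?n p \<and> p 0 = x \<and> p ?n = y}"
  proof safe
    fix n p assume "up_right n p" "x = p 0" "y = p n"
    with up_right_level[of n p] have "n = nat (level (p n) - level (p 0))" by simp
    with \<open>up_right n p\<close> show "\<exists>pa. (\<Sum>k<n. \<omega> (p k)) = (\<Sum>k<nat (level (p n) - level (p 0)). \<omega> (pa k)) \<and>
        up_right (nat (level (p n) - level (p 0))) pa \<and> pa 0 = p 0 \<and> pa (nat (level (p n) - level (p 0))) = p n"
      by (metis (no_types))
  qed
  moreover have "finite {\<Sum>k<?n. \<omega> (p k) | p. up_right ?n p \<and> p 0 = x \<and> p ?n = y}"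
    by (rule finite_path_values) simp
  ultimately show ?thesis by (rule finite_subset)
qed

lemma G_ge: "up_right n p \<Longrightarrow> (\<Sum>k<n. \<omega> (p k)) \<le> G \<omega> (p 0) (p n)"
  unfolding G_def by (rule Max_ge[OF finite_G_values]) blast

lemma finite_G_pl_values: "finite {(\<Sum>k<n. \<omega> (p k)) + h \<bullet> rvec (p n) | p. up_right n p \<and> p 0 = 0}"
  for \<omega> :: env
  using finite_path_values[where F = "\<lambda>p. (\<Sum>k<n. \<omega> (p k)) + h \<bullet> rvec (p n)" and Q = "\<lambda>_. True" and n = n and x = 0]
  by simp

lemma G_pl_ge: "up_right n p \<Longrightarrow> p 0 = 0 \<Longrightarrow> (\<Sum>k<n. \<omega> (p k)) + h \<bullet> rvec (p n) \<le> G_pl \<omega> h n"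
  unfolding G_pl_def by (rule Max_ge[OF finite_G_pl_values]) blast

lemma path_extension:
  assumes "up_right n p" and "p n \<le> z" and "level z = level (p n) + int d"
  shows "\<exists>q. up_right (n + d) q \<and> q (n + d) = z \<and> (\<forall>k\<le>n. q k = p k)"
  using assms
proof (induction d arbitrary: n p)
  case 0
  then have "p n = z" by (auto simp: level_def less_eq_prod_def prod_eq_iff)
  with 0 show ?case by auto
next
  case (Suc d)
  define i :: nat where "i = (if fst (p n) < fst z then 1 else 2)"
  have i: "i \<in> {1, 2}" "p n + e i \<le> z"
    using Suc.prems by (auto simp: i_def e_def less_eq_prod_def level_def)
  define q where "q = p(Suc n := p n + e i)"
  have q: "up_right (Suc n) q" "q (Suc n) \<le> z" "level z = level (q (Suc n)) + int d"
    using Suc.prems i by (auto simp: q_def up_right_def level_def less_Suc_eq) (auto simp: i_def e_def)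
  from Suc.IH[OF q] obtain r where "up_right (Suc n + d) r" "r (Suc n + d) = z" "\<forall>k\<le>Suc n. r k = q k"
    by blast
  then show ?case by (intro exI[of _ r]) (auto simp: q_def)
qed

lemma G_attained:
  assumes "x \<le> y"
  obtains n p where "up_right n p" "p 0 = x" "p n = y" "G \<omega> x y = (\<Sum>k<n. \<omega> (p k))"
    "level y = level x + int n"
proof -
  let ?S = "{\<Sum>k<n. \<omega> (p k) | n p. up_right n p \<and> p 0 = x \<and> p n = y}"
  have "level y = level x + int (nat (level y - level x))"
    using assms by (auto simp: level_def less_eq_prod_def)
  then obtain q where "up_right (nat (level y - level x)) q" "q (nat (level y - level x)) = y" "q 0 = x"
    using path_extension[of 0 "\<lambda>_. x" y "nat (level y - level x)"] assms by (auto simp: up_right_def)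
  then have "?S \<noteq> {}" by auto
  from Max_in[OF finite_G_values this] obtain n p
    where p: "up_right n p" "p 0 = x" "p n = y" "G \<omega> x y = (\<Sum>k<n. \<omega> (p k))"
    unfolding G_def[symmetric] by auto
  then show ?thesis using that up_right_level[OF p(1)] by auto
qed

lemma G_pl_attained:
  obtains p where "up_right n p" "p 0 = 0" "G_pl \<omega> h n = (\<Sum>k<n. \<omega> (p k)) + h \<bullet> rvec (p n)"
proof -
  let ?S = "{(\<Sum>k<n. \<omega> (p k)) + h \<bullet> rvec (p n) | p. up_right n p \<and> p 0 = 0}"
  obtain q where "up_right n q" "q 0 = 0"
    using path_extension[of 0 "\<lambda>_. 0" "(int n, 0)" n] by (auto simp: up_right_def level_def less_eq_prod_def)
  then have "?S \<noteq> {}" by auto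
  from Max_in[OF finite_G_pl_values this] that show ?thesis
    unfolding G_pl_def[symmetric] by auto
qed

text \<open>With weights bounded below, a path can be prolonged to any larger site at a cost that is linear
  in the number of added steps; this is the monotonicity of passage times up to an error.\<close>

lemma sum_path_extension_ge:
  assumes p: "up_right n p" "p n \<le> z" and c: "\<And>x. c \<le> \<omega> x"
  obtains q d where "up_right (n + d) q" "q 0 = p 0" "q (n + d) = z" "level z = level (p n) + int d"
    "(\<Sum>k<n. \<omega> (p k)) + c * real d \<le> (\<Sum>k<n + d. \<omega> (q k))"
proof -
  define d where "d = nat (level z - level (p n))"
  have d: "level z = level (p n) + int d"
    using p by (auto simp: level_def less_eq_prod_def d_def)
  from path_extension[OF p this] obtain q
    where q: "up_right (n + d) q" "q (n + d) = z" "\<forall>k\<le>n. q k = p k" by blast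
  have "(\<Sum>k<n + d. \<omega> (q k)) = (\<Sum>k<n. \<omega> (q k)) + (\<Sum>k\<in>{n..<n + d}. \<omega> (q k))"
    by (subst sum.union_disjoint[symmetric]) (auto intro!: sum.cong)
  moreover have "(\<Sum>k\<in>{n..<n + d}. \<omega> (q k)) \<ge> (\<Sum>k\<in>{n..<n + d}. c)"
    by (rule sum_mono) (rule c)
  ultimately show ?thesis using q d that by (simp add: mult.commute)
qed

section \<open>The point-to-level limit shape as a concave dual\<close>

lemma floor_scaled_tendsto: "(\<lambda>n. real_of_int \<lfloor>real n * a\<rfloor> / real n) \<longlonglongrightarrow> a"
proof (rule tendsto_sandwich)
  show "\<forall>\<^sub>F n in sequentially. a - 1 / real n \<le> real_of_int \<lfloor>real n * a\<rfloor> / real n"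
    using eventually_gt_at_top[of 0]
  proof eventually_elim
    case (elim n)
    have "real n * a - 1 \<le> real_of_int \<lfloor>real n * a\<rfloor>" by linarith
    from divide_right_mono[OF this, of "real n"] elim show ?case by (simp add: diff_divide_distrib)
  qed
  show "\<forall>\<^sub>F n in sequentially. real_of_int \<lfloor>real n * a\<rfloor> / real n \<le> a"
    using eventually_gt_at_top[of 0]
  proof eventually_elim
    case (elim n)
    have "real_of_int \<lfloor>real n * a\<rfloor> \<le> real n * a" by linarith
    with elim show ?case by (simp add: field_simps)
  qed
  show "(\<lambda>n. a - 1 / real n) \<longlonglongrightarrow> a"
    using tendsto_diff[OF tendsto_const lim_1_over_n] by simp
qed simp

lemma inner_floor_vec_tendsto: "(\<lambda>n. h \<bullet> rvec (floor_vec (real n *\<^sub>R \<xi>)) / real n) \<longlonglongrightarrow> h \<bullet> \<xi>"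
proof -
  have "(\<lambda>n. fst h * (real_of_int \<lfloor>real n * fst \<xi>\<rfloor> / real n) + snd h * (real_of_int \<lfloor>real n * snd \<xi>\<rfloor> / real n))
      \<longlonglongrightarrow> fst h * fst \<xi> + snd h * snd \<xi>"
    by (intro tendsto_intros floor_scaled_tendsto)
  then show ?thesis
    by (simp add: rvec_def floor_vec_def inner_prod_def add_divide_distrib)
qed

lemma (in prob_space) AE_limit_unique:
  fixes a b :: real
  assumes "AE \<omega> in M. X \<omega> \<longlonglongrightarrow> a" "AE \<omega> in M. X \<omega> \<longlonglongrightarrow> b"
  shows "a = b"
proof -
  have "AE \<omega> in M. a = b"
    using assms by eventually_elim (rule LIMSEQ_unique)
  then show ?thesis by simp
qed

text \<open>The floors of the two coordinates of \<open>n \<xi>\<close> may lose one unit of level, so that one extra step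
  can be needed to reach level \<open>n\<close>. The terms \<open>c\<close> and \<open>norm h\<close> pay for it.\<close>

lemma G_pl_ge_G:
  assumes \<xi>: "\<xi> \<in> riU" and c: "\<And>x. c \<le> \<omega> x" "c \<le> 0"
  shows "G \<omega> 0 (floor_vec (real n *\<^sub>R \<xi>)) + h \<bullet> rvec (floor_vec (real n *\<^sub>R \<xi>)) + c - norm h \<le> G_pl \<omega> h n"
proof -
  define x where "x = floor_vec (real n *\<^sub>R \<xi>)"
  have x0: "0 \<le> x"
    using \<xi> by (auto simp: x_def floor_vec_def less_eq_prod_def riU_iff)
  have "real n * fst \<xi> + real n * snd \<xi> = real n"
    using \<xi> by (simp add: riU_iff flip: distrib_left)
  then have lev: "level x \<le> int n" "int n - level x \<le> 1"
    unfolding level_def x_def floor_vec_def by (simp_all) linarith+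
  from G_attained[OF x0] obtain m p
    where p: "up_right m p" "p 0 = 0" "p m = x" "G \<omega> 0 x = (\<Sum>k<m. \<omega> (p k))"
      and m: "level x = level 0 + int m" .
  define j where "j = nat (int n - level x)"
  define z where "z = x + (int j, 0)"
  have "p m \<le> z" by (simp add: p z_def less_eq_prod_def)
  from sum_path_extension_ge[OF p(1) this c(1)] obtain q d where
    q: "up_right (m + d) q" "q 0 = p 0" "q (m + d) = z" "level z = level (p m) + int d"
      "(\<Sum>k<m. \<omega> (p k)) + c * real d \<le> (\<Sum>k<m + d. \<omega> (q k))" .
  have dj: "d = j" using q(4) p(3) by (simp add: z_def level_def)
  have mn: "m + d = n" using m lev by (simp add: dj j_def level_def)
  have j1: "real j \<le> 1" using lev by (simp add: j_def)
  have "G_pl \<omega> h n \<ge> (\<Sum>k<n. \<omega> (q k)) + h \<bullet> rvec z"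
    using G_pl_ge[OF q(1), of \<omega> h] q(2,3) p(2) by (simp add: mn)
  moreover have "h \<bullet> rvec z = h \<bullet> rvec x + fst h * real j"
    by (simp add: z_def rvec_def inner_prod_def algebra_simps)
  moreover have "- norm h \<le> fst h * real j"
  proof -
    have "\<bar>fst h * real j\<bar> \<le> \<bar>fst h\<bar> * 1"
      unfolding abs_mult using j1 by (intro mult_left_mono) auto
    also have "\<bar>fst h\<bar> \<le> norm h" using norm_fst_le[of "fst h" "snd h"] by simp
    finally show ?thesis by linarith
  qed
  moreover have "c \<le> c * real d"
    using mult_left_mono_neg[OF j1 c(2)] by (simp add: dj)
  ultimately show ?thesis
    using q(5) p(4) unfolding mn x_def[symmetric] by linarith
qed

text \<open>Each endpoint on level \<open>n\<close> lies below one of the \<open>m + 1\<close> grid points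
  \<open>n \<eta>\<^sub>j\<close>, whose level is \<open>(1 + 2 / m) n\<close>. Prolonging the maximal path to the grid point
  costs \<open>O(n / m)\<close>. Both coordinates of \<open>\<eta>\<^sub>j\<close> are positive, so that the supporting
  line on the open quadrant applies to them.\<close>

lemma G_pl_le_grid:
  assumes m: "0 < m" and n: "0 < n" and c: "\<And>x. c \<le> \<omega> x" "c \<le> 0"
    and G: "\<And>j. j \<le> m \<Longrightarrow> G \<omega> 0 (floor_vec (real n *\<^sub>R ((real j + 1) / real m, (real (m - j) + 1) / real m))) / real n
      + h \<bullet> ((real j + 1) / real m, (real (m - j) + 1) / real m) \<le> b"
  shows "G_pl \<omega> h n / real n \<le> b + 2 * (\<bar>fst h\<bar> + \<bar>snd h\<bar> - c) / real m"
proof -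
  from G_pl_attained obtain p where
    p: "up_right n p" "p 0 = 0" "G_pl \<omega> h n = (\<Sum>k<n. \<omega> (p k)) + h \<bullet> rvec (p n)" .
  define a where "a = nat (fst (p n))"
  \<comment> \<open>The grid cell that contains the first coordinate of the endpoint.\<close>
  define j where "j = a * m div n"
  have "0 \<le> p n" using up_right_start_le[OF p(1)] p(2) by simp
  moreover have "fst (p n) + snd (p n) = int n"
    using up_right_level[OF p(1)] p(2) by (simp add: level_def)
  ultimately have a: "a \<le> n" "p n = (int a, int n - int a)"
    by (auto simp: a_def less_eq_prod_def prod_eq_iff)
  have jm: "j \<le> m"
    using a n unfolding j_def by (metis div_le_mono div_mult_self_is_m mult_le_mono1 mult.commute)
  have j1: "real j * real n \<le> real a * real m"
    unfolding j_def using div_times_less_eq_dividend[of "a * m" n] by (metis of_nat_le_iff of_nat_mult)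
  have j2: "real a * real m \<le> (real j + 1) * real n"
  proof -
    have "a * m < Suc (a * m div n) * n"
      using n dividend_less_div_times[of n "a * m"] by simp
    then have "real (a * m) \<le> real (Suc j * n)" unfolding j_def of_nat_le_iff by simp
    then show ?thesis by (simp add: algebra_simps)
  qed
  define \<eta> where "\<eta> = ((real j + 1) / real m, (real (m - j) + 1) / real m)"
  define u where "u = real n * fst \<eta> - real a"
  define v where "v = real n * snd \<eta> - (real n - real a)"
  have uv: "0 \<le> u" "u \<le> 2 * real n / real m" "0 \<le> v" "v \<le> 2 * real n / real m"
  proof -
    have "u = ((real j + 1) * real n - real a * real m) / real m"
      "v = (real n - (real j * real n - real a * real m)) / real m"
      using jm m by (simp_all add: u_def v_def \<eta>_def of_nat_diff field_simps)
    then show "0 \<le> u" "u \<le> 2 * real n / real m" "0 \<le> v" "v \<le> 2 * real n / real m"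
      using j1 j2 by (auto simp: algebra_simps intro!: divide_nonneg_nonneg divide_right_mono)
  qed
  define y where "y = floor_vec (real n *\<^sub>R \<eta>)"
  have "p n \<le> y"
    using uv(1,3) by (auto simp: a y_def floor_vec_def less_eq_prod_def le_floor_iff u_def v_def)
  from sum_path_extension_ge[OF p(1) this c(1)] obtain q d where
    q: "up_right (n + d) q" "q 0 = p 0" "q (n + d) = y" "level y = level (p n) + int d"
      "(\<Sum>k<n. \<omega> (p k)) + c * real d \<le> (\<Sum>k<n + d. \<omega> (q k))" .
  have "(\<Sum>k<n + d. \<omega> (q k)) \<le> G \<omega> 0 y"
    using G_ge[OF q(1), of \<omega>] q(2,3) p(2) by simp
  moreover have "c * (2 * real n / real m) \<le> c * real d"
  proof (rule mult_left_mono_neg)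
    have "real d = real_of_int (level y) - real n"
      using q(4) a by (simp add: level_def)
    also have "real_of_int (level y) \<le> real n * fst \<eta> + real n * snd \<eta>"
      unfolding level_def y_def floor_vec_def by (simp, linarith)
    also have "\<dots> - real n = 2 * real n / real m"
      using jm m by (simp add: \<eta>_def of_nat_diff field_simps)
    finally show "real d \<le> 2 * real n / real m" by simp
  qed (rule c(2))
  moreover have "h \<bullet> rvec (p n) \<le> real n * (h \<bullet> \<eta>) + (\<bar>fst h\<bar> + \<bar>snd h\<bar>) * (2 * real n / real m)"
  proof -
    have "h \<bullet> rvec (p n) = real n * (h \<bullet> \<eta>) - fst h * u - snd h * v"
      by (simp add: a rvec_def inner_prod_def u_def v_def algebra_simps)
    moreover have "\<bar>fst h * u\<bar> \<le> \<bar>fst h\<bar> * (2 * real n / real m)"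
      unfolding abs_mult using uv by (intro mult_left_mono) auto
    moreover have "\<bar>snd h * v\<bar> \<le> \<bar>snd h\<bar> * (2 * real n / real m)"
      unfolding abs_mult using uv by (intro mult_left_mono) auto
    ultimately show ?thesis unfolding distrib_right by linarith
  qed
  moreover have "G \<omega> 0 y + real n * (h \<bullet> \<eta>) \<le> b * real n"
    using G[OF jm] n unfolding \<eta>_def[symmetric] y_def[symmetric] by (simp add: field_simps)
  ultimately have "G_pl \<omega> h n \<le> b * real n + (\<bar>fst h\<bar> + \<bar>snd h\<bar> - c) * (2 * real n / real m)"
    using q(5) unfolding p(3) distrib_right left_diff_distrib by linarith
  also have "\<dots> = real n * (b + 2 * (\<bar>fst h\<bar> + \<bar>snd h\<bar> - c) / real m)"
    using m by (simp add: field_simps)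
  finally show ?thesis using n by (simp add: field_simps)
qed

context corner_growth
begin

lemma space_P [simp]: "space P = UNIV"
  using sets_eq_imp_space_eq[OF sets_P] by (simp add: Omega_def space_PiM)

lemma measurable_coordinate [measurable]: "(\<lambda>\<omega>. \<omega> x) \<in> borel_measurable P"
  unfolding measurable_cong_sets[OF sets_P refl] Omega_def by (rule measurable_component_singleton) simp

lemma weights_bounded_below:
  obtains c where "c \<le> 0" and "AE \<omega> in P. \<forall>x. c \<le> \<omega> x"
proof -
  from bounded_below obtain c where "AE \<omega> in P. c \<le> \<omega> 0" by blast
  then have "AE y in distr P borel (\<lambda>\<omega>. \<omega> 0). c \<le> y"
    by (simp add: AE_distr_iff)
  then have "AE y in distr P borel (\<lambda>\<omega>. \<omega> x). c \<le> y" for x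
    unfolding ident[of x] .
  then have low: "AE \<omega> in P. c \<le> \<omega> x" for x
    by (simp add: AE_distr_iff)
  have "AE \<omega> in P. min c 0 \<le> \<omega> x" for x
    using low[of x] by eventually_elim simp
  then have "AE \<omega> in P. \<forall>x. min c 0 \<le> \<omega> x"
    by (simp add: AE_all_countable)
  then show ?thesis using that[of "min c 0"] by simp
qed

lemma integrable_weight: "integrable P (\<lambda>\<omega>. \<omega> 0)"
proof -
  from moment obtain p where p: "p > 2" "integrable P (\<lambda>\<omega>. \<bar>\<omega> 0\<bar> powr p)" by blast
  have le: "\<bar>x\<bar> \<le> \<bar>1 + \<bar>x\<bar> powr p\<bar>" for x :: real
  proof (cases "\<bar>x\<bar> \<le> 1")
    case False
    then have "\<bar>x\<bar> powr 1 \<le> \<bar>x\<bar> powr p" using p by (intro powr_mono) auto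
    with False show ?thesis by simp
  qed (simp add: add_increasing2)
  have "integrable P (\<lambda>\<omega>. 1 + \<bar>\<omega> 0\<bar> powr p)"
    using p by simp
  then show ?thesis
    by (rule Bochner_Integration.integrable_bound) (simp_all only: le real_norm_def measurable_coordinate AE_I2)
qed

end

context corner_growth_limits
begin

lemma gpp_tendsto:
  assumes "0 \<le> \<xi>"
  shows "AE \<omega> in P. (\<lambda>n. G \<omega> 0 (floor_vec (real n *\<^sub>R \<xi>)) / real n) \<longlonglongrightarrow> gpp P \<xi>"
  unfolding gpp_def
  by (rule theI'[OF ex_ex1I[OF pp_limit[OF assms] AE_limit_unique]])

lemma gpl_tendsto: "AE \<omega> in P. (\<lambda>n. G_pl \<omega> h n / real n) \<longlonglongrightarrow> gpl P h"
  unfolding gpl_def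
  by (rule theI'[OF ex_ex1I[OF pl_limit AE_limit_unique]])

lemma gpl_ge_gpp:
  assumes \<xi>: "\<xi> \<in> riU"
  shows "gpp P \<xi> + h \<bullet> \<xi> \<le> gpl P h"
proof -
  obtain c where c: "c \<le> 0" "AE \<omega> in P. \<forall>x. c \<le> \<omega> x" using weights_bounded_below .
  have "0 \<le> \<xi>" using \<xi> by (simp add: riU_iff less_eq_prod_def)
  from gpp_tendsto[OF this] gpl_tendsto[of h] c(2)
  have "AE \<omega> in P. gpp P \<xi> + h \<bullet> \<xi> \<le> gpl P h"
  proof eventually_elim
    case (elim \<omega>)
    let ?x = "\<lambda>n. floor_vec (real n *\<^sub>R \<xi>)"
    have "(\<lambda>n. G \<omega> 0 (?x n) / real n + h \<bullet> rvec (?x n) / real n + (c - norm h) * (1 / real n))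
        \<longlonglongrightarrow> gpp P \<xi> + h \<bullet> \<xi> + (c - norm h) * 0"
      by (intro tendsto_intros elim inner_floor_vec_tendsto lim_1_over_n)
    moreover have "G \<omega> 0 (?x n) / real n + h \<bullet> rvec (?x n) / real n + (c - norm h) * (1 / real n)
        \<le> G_pl \<omega> h n / real n" for n
      using divide_right_mono[OF G_pl_ge_G[OF \<xi>, of c \<omega> n h], of "real n"] elim(3) c(1)
      by (simp add: add_divide_distrib diff_divide_distrib)
    ultimately show ?case
      using LIMSEQ_le[OF _ elim(2)] by auto
  qed
  then show ?thesis by simp
qed

text \<open>On each grid the finitely many limits bound the growth rate by \<open>t + O(1 / m)\<close>, and the mesh is
  arbitrary.\<close>

lemma gpl_le_supporting_line:
  assumes t: "\<And>\<zeta>. 0 < fst \<zeta> \<Longrightarrow> 0 < snd \<zeta> \<Longrightarrow> gpp P \<zeta> + h \<bullet> \<zeta> \<le> t * (fst \<zeta> + snd \<zeta>)"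
  shows "gpl P h \<le> t"
proof -
  obtain c where c: "c \<le> 0" "AE \<omega> in P. \<forall>x. c \<le> \<omega> x" using weights_bounded_below .
  define C where "C = 2 * t + 1 + 2 * (\<bar>fst h\<bar> + \<bar>snd h\<bar> - c)"
  have bound: "gpl P h \<le> t + C / real m" if m: "0 < m" for m
  proof -
    define \<eta> where "\<eta> = (\<lambda>j. ((real j + 1) / real m, (real (m - j) + 1) / real m))"
    have pos: "0 < fst (\<eta> j)" "0 < snd (\<eta> j)" for j
      using m by (auto simp: \<eta>_def)
    then have "0 \<le> \<eta> j" for j by (simp add: less_eq_prod_def less_imp_le)
    from gpp_tendsto[OF this]
    have "AE \<omega> in P. \<forall>j. (\<lambda>n. G \<omega> 0 (floor_vec (real n *\<^sub>R \<eta> j)) / real n) \<longlonglongrightarrow> gpp P (\<eta> j)"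
      by (simp add: AE_all_countable)
    with gpl_tendsto[of h] c(2) have "AE \<omega> in P. gpl P h \<le> t + C / real m"
    proof eventually_elim
      case (elim \<omega>)
      have "\<forall>\<^sub>F n in sequentially. G \<omega> 0 (floor_vec (real n *\<^sub>R \<eta> j)) / real n < gpp P (\<eta> j) + 1 / real m" for j
        using elim(3) m by (intro order_tendstoD) auto
      then have "\<forall>\<^sub>F n in sequentially. \<forall>j\<in>{..m}. G \<omega> 0 (floor_vec (real n *\<^sub>R \<eta> j)) / real n < gpp P (\<eta> j) + 1 / real m"
        by (simp add: eventually_ball_finite)
      with eventually_gt_at_top[of 0]
      have "\<forall>\<^sub>F n in sequentially. G_pl \<omega> h n / real n \<le> t + C / real m"
      proof eventually_elim
        case (elim n)
        have "G \<omega> 0 (floor_vec (real n *\<^sub>R \<eta> j)) / real n + h \<bullet> \<eta> j \<le> t + (2 * t + 1) / real m" if "j \<le> m" for j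
        proof -
          have "fst (\<eta> j) + snd (\<eta> j) = 1 + 2 / real m"
            using m that by (simp add: \<eta>_def of_nat_diff field_simps)
          with t[OF pos] have "gpp P (\<eta> j) + h \<bullet> \<eta> j \<le> t * (1 + 2 / real m)" by metis
          moreover have "G \<omega> 0 (floor_vec (real n *\<^sub>R \<eta> j)) / real n < gpp P (\<eta> j) + 1 / real m"
            using elim(2) that by simp
          ultimately have "G \<omega> 0 (floor_vec (real n *\<^sub>R \<eta> j)) / real n + h \<bullet> \<eta> j \<le> t * (1 + 2 / real m) + 1 / real m"
            by linarith
          also have "\<dots> = t + (2 * t + 1) / real m" by (simp add: add_divide_distrib distrib_left)
          finally show ?thesis .
        qed
        from G_pl_le_grid[OF m elim(1) _ c(1) this[unfolded \<eta>_def]] \<open>\<forall>x. c \<le> \<omega> x\<close>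
        have "G_pl \<omega> h n / real n \<le> t + (2 * t + 1) / real m + 2 * (\<bar>fst h\<bar> + \<bar>snd h\<bar> - c) / real m"
          by blast
        then show ?case by (simp add: C_def add_divide_distrib)
      qed
      with elim(1) show ?case by (intro tendsto_upperbound) auto
    qed
    then show ?thesis by simp
  qed
  have "(\<lambda>m. t + C * (1 / real m)) \<longlonglongrightarrow> t + C * 0"
    by (intro tendsto_intros lim_1_over_n)
  then show ?thesis
    using bound by (intro tendsto_lowerbound[of _ t sequentially])
      (auto intro!: eventually_mono[OF eventually_gt_at_top[of 0]])
qed

end

section \<open>Dual directions\<close>

context corner_growth_limits
begin

lemma grad_gpp_supergradient:
  assumes \<xi>: "\<xi> \<in> riU"
  shows "grad (gpp P) s \<xi> \<bullet> \<xi> = gpp P \<xi>"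
    and "0 < fst \<zeta> \<Longrightarrow> 0 < snd \<zeta> \<Longrightarrow> gpp P \<zeta> \<le> grad (gpp P) s \<xi> \<bullet> \<zeta>"
proof -
  note Plus = grad_Plus_supergradient[OF gpp_concave gpp_homogeneous]
  have swap: "prod.swap \<xi> \<in> riU" using \<xi> by (simp add: riU_iff add.commute)
  have Minus: "grad (gpp P) Minus \<xi> \<bullet> \<zeta> = grad (gpp P) Plus (prod.swap \<xi>) \<bullet> prod.swap \<zeta>" for \<zeta>
  proof -
    have "grad (gpp P) Minus \<xi> = prod.swap (grad (gpp P) Plus (prod.swap \<xi>))"
      by (rule grad_Minus_eq_swap[OF _ \<xi>]) (rule gpp_symmetric)
    then show ?thesis by (simp add: inner_prod_def)
  qed
  have sym: "gpp P (prod.swap \<zeta>) = gpp P \<zeta>" if "0 < fst \<zeta>" "0 < snd \<zeta>" for \<zeta>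
    using gpp_symmetric[of "snd \<zeta>" "fst \<zeta>"] that by (cases \<zeta>) auto
  show "grad (gpp P) s \<xi> \<bullet> \<xi> = gpp P \<xi>"
    using Plus(1)[OF _ _ \<xi>] Plus(1)[OF _ _ swap] sym[of \<xi>] \<xi> by (cases s) (auto simp: Minus riU_iff)
  show "gpp P \<zeta> \<le> grad (gpp P) s \<xi> \<bullet> \<zeta>" if "0 < fst \<zeta>" "0 < snd \<zeta>"
    using Plus(2)[OF _ _ \<xi>, of \<zeta>] Plus(2)[OF _ _ swap, of "prod.swap \<zeta>"] sym[of \<zeta>] that
    by (cases s) (auto simp: Minus)
qed

text \<open>Supporting lines and Euler's identity are preserved under convex combinations of the two one-sided
  gradients; the shift by \<open>t\<close> becomes a multiple of the level because
  \<open>e\<^sub>1 + e\<^sub>2\<close> pairs with \<open>\<zeta>\<close> to the sum of its coordinates.\<close>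

lemma dual_dir_supporting_line:
  assumes d: "dual_dir P h t \<xi>"
  shows "gpp P \<xi> + h \<bullet> \<xi> = t"
    and "0 < fst \<zeta> \<Longrightarrow> 0 < snd \<zeta> \<Longrightarrow> gpp P \<zeta> + h \<bullet> \<zeta> \<le> t * (fst \<zeta> + snd \<zeta>)"
proof -
  from d have \<xi>: "\<xi> \<in> riU" by (simp add: dual_dir_def)
  from d obtain v u where v: "h - t *\<^sub>R (rvec (e 1) + rvec (e 2)) = - v"
    and u: "0 \<le> u" "u \<le> 1" "v = (1 - u) *\<^sub>R grad (gpp P) Plus \<xi> + u *\<^sub>R grad (gpp P) Minus \<xi>"
    unfolding dual_dir_def closed_segment_def by blast
  have h: "h = t *\<^sub>R (1, 1) - v" using v by (simp add: algebra_simps)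
  have "v \<bullet> \<xi> = (1 - u) * gpp P \<xi> + u * gpp P \<xi>"
    by (simp add: u inner_add_left grad_gpp_supergradient(1)[OF \<xi>])
  then have "v \<bullet> \<xi> = gpp P \<xi>" by (simp add: algebra_simps)
  moreover have "t * fst \<xi> + t * snd \<xi> = t" using \<xi> by (simp add: riU_iff flip: distrib_left)
  ultimately show "gpp P \<xi> + h \<bullet> \<xi> = t"
    by (simp add: h inner_diff_left) (simp add: inner_prod_def)
  assume z: "0 < fst \<zeta>" "0 < snd \<zeta>"
  have "gpp P \<zeta> = (1 - u) * gpp P \<zeta> + u * gpp P \<zeta>" by (simp add: algebra_simps)
  also have "\<dots> \<le> (1 - u) * (grad (gpp P) Plus \<xi> \<bullet> \<zeta>) + u * (grad (gpp P) Minus \<xi> \<bullet> \<zeta>)"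
    using u z by (intro add_mono mult_left_mono grad_gpp_supergradient(2)[OF \<xi>]) auto
  also have "\<dots> = v \<bullet> \<zeta>" by (simp add: u inner_add_left)
  finally show "gpp P \<zeta> + h \<bullet> \<zeta> \<le> t * (fst \<zeta> + snd \<zeta>)"
    by (simp add: h inner_diff_left) (simp add: inner_prod_def algebra_simps)
qed

lemma gpl_eq_dual: "dual_dir P h t \<xi> \<Longrightarrow> gpl P h = t"
  using gpl_ge_gpp[of \<xi> h] gpl_le_supporting_line[of h t] dual_dir_supporting_line[of h t \<xi>]
  by (force simp: dual_dir_def intro: antisym)

lemma grad_gpp_on_diff_dirs:
  assumes "\<xi> \<in> diff_dirs P"
  shows "grad (gpp P) s \<xi> = grad (gpp P) s' \<xi>"
proof -
  from assms obtain f' where f': "(gpp P has_derivative f') (at \<xi>)"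
    by (auto simp: diff_dirs_def differentiable_def)
  then interpret bounded_linear f' by (rule has_derivative_bounded_linear)
  have "f' u = (f' (1, 0), f' (0, 1)) \<bullet> u" for u
    using add[of "fst u *\<^sub>R (1, 0)" "snd u *\<^sub>R (0, 1)"] scaleR[of "fst u" "(1, 0)"] scaleR[of "snd u" "(0, 1)"]
    by (simp add: inner_prod_def mult.commute)
  then have "f' = (\<lambda>u. (f' (1, 0), f' (0, 1)) \<bullet> u)" by blast
  with f' have "(gpp P has_derivative (\<lambda>u. (f' (1, 0), f' (0, 1)) \<bullet> u)) (at \<xi>)" by metis
  from grad_eq_if_has_derivative[OF this] show ?thesis by simp
qed

text \<open>The supporting line of \<open>h\<close> is attained at every dual direction. These fill the segment,
  so by homogeneity \<open>gpp P\<close> agrees with a linear function on the cone over the segment, which is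
  a neighbourhood of each interior point.\<close>

lemma gpp_linear_near_flat_segment:
  assumes d: "duality_data P h t \<xi>lo \<xi>hi" and \<xi>: "\<xi> \<in> open_segment \<xi>lo \<xi>hi"
  shows "(gpp P has_derivative (\<lambda>u. (t *\<^sub>R (1, 1) - h) \<bullet> u)) (at \<xi>)"
proof -
  have le: "fst \<xi>lo \<le> fst \<xi>hi" and dual: "dual_dir P h t \<zeta> \<longleftrightarrow> \<zeta> \<in> closed_segment \<xi>lo \<xi>hi" for \<zeta>
    using d by (auto simp: duality_data_def)
  have ends: "\<xi>lo \<in> riU" "\<xi>hi \<in> riU" "\<xi> \<in> riU"
    using dual[of \<xi>lo] dual[of \<xi>hi] dual[of \<xi>] \<xi> by (auto simp: dual_dir_def open_segment_def)
  from \<xi> obtain u where u: "0 < u" "u < 1" "\<xi> = (1 - u) *\<^sub>R \<xi>lo + u *\<^sub>R \<xi>hi" and ne: "\<xi>lo \<noteq> \<xi>hi"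
    by (auto simp: in_segment)
  have lt: "fst \<xi>lo < fst \<xi>hi"
    using le ends ne by (cases "fst \<xi>lo = fst \<xi>hi") (auto simp: riU_iff prod_eq_iff)
  have "fst \<xi> - fst \<xi>lo = u * (fst \<xi>hi - fst \<xi>lo)" "fst \<xi>hi - fst \<xi> = (1 - u) * (fst \<xi>hi - fst \<xi>lo)"
    by (simp_all add: u(3) algebra_simps)
  then have between: "fst \<xi>lo < fst \<xi>" "fst \<xi> < fst \<xi>hi"
    using u lt by (metis diff_gt_0_iff_gt mult_pos_pos)+
  \<comment> \<open>\<open>\<rho>\<close> is the first coordinate of the central projection onto the simplex.\<close>
  define \<rho> where "\<rho> = (\<lambda>\<zeta> :: real \<times> real. fst \<zeta> / (fst \<zeta> + snd \<zeta>))"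
  have "(\<rho> \<longlongrightarrow> \<rho> \<xi>) (nhds \<xi>)"
    unfolding \<rho>_def using ends(3) by (intro tendsto_intros filterlim_ident) (auto simp: riU_iff)
  moreover have "\<rho> \<xi> = fst \<xi>" using ends(3) by (simp add: \<rho>_def riU_iff)
  ultimately have "\<forall>\<^sub>F \<zeta> in nhds \<xi>. fst \<xi>lo < \<rho> \<zeta>" "\<forall>\<^sub>F \<zeta> in nhds \<xi>. \<rho> \<zeta> < fst \<xi>hi"
    using between by (auto intro: order_tendstoD)
  moreover have "(fst \<longlongrightarrow> fst \<xi>) (nhds \<xi>)" "(snd \<longlongrightarrow> snd \<xi>) (nhds \<xi>)"
    by (intro tendsto_fst tendsto_snd filterlim_ident)+
  then have "\<forall>\<^sub>F \<zeta> in nhds \<xi>. 0 < fst \<zeta>" "\<forall>\<^sub>F \<zeta> in nhds \<xi>. 0 < snd \<zeta>"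
    using ends(3) by (auto simp: riU_iff dest: order_tendstoD(1)[where a = 0])
  ultimately have "\<forall>\<^sub>F \<zeta> in nhds \<xi>. gpp P \<zeta> = (t *\<^sub>R (1, 1) - h) \<bullet> \<zeta>"
  proof eventually_elim
    case (elim \<zeta>)
    define c where "c = fst \<zeta> + snd \<zeta>"
    have c: "0 < c" using elim by (simp add: c_def)
    define \<eta> where "\<eta> = (\<rho> \<zeta>, 1 - \<rho> \<zeta>)"
    have \<zeta>: "\<zeta> = c *\<^sub>R \<eta>"
      using c by (simp add: \<eta>_def \<rho>_def prod_eq_iff c_def[symmetric] right_diff_distrib) (simp add: c_def)
    define q where "q = (\<rho> \<zeta> - fst \<xi>lo) / (fst \<xi>hi - fst \<xi>lo)"
    have q: "0 \<le> q" "q \<le> 1" "q * (fst \<xi>hi - fst \<xi>lo) = \<rho> \<zeta> - fst \<xi>lo"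
      using elim lt by (auto simp: q_def)
    have snds: "snd \<xi>lo = 1 - fst \<xi>lo" "snd \<xi>hi = 1 - fst \<xi>hi" using ends by (auto simp: riU_iff)
    have "\<eta> = (1 - q) *\<^sub>R \<xi>lo + q *\<^sub>R \<xi>hi"
      using q(3) by (simp add: \<eta>_def prod_eq_iff snds algebra_simps)
    with q have "dual_dir P h t \<eta>" unfolding dual in_segment by blast
    from dual_dir_supporting_line(1)[OF this] have g: "gpp P \<eta> = t - h \<bullet> \<eta>" by simp
    have "0 \<le> \<eta>" using \<open>dual_dir P h t \<eta>\<close> by (auto simp: dual_dir_def riU_iff less_eq_prod_def)
    with c have "gpp P \<zeta> = c * gpp P \<eta>" unfolding \<zeta> by (intro gpp_homogeneous) auto
    also have "\<dots> = (t *\<^sub>R (1, 1) - h) \<bullet> \<zeta>"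
      by (simp add: g \<zeta> inner_diff_left) (simp add: \<eta>_def inner_prod_def algebra_simps)
    finally show ?case .
  qed
  then have "\<forall>\<^sub>F \<zeta> in at \<xi> within UNIV. gpp P \<zeta> = (t *\<^sub>R (1, 1) - h) \<bullet> \<zeta>"
    "gpp P \<xi> = (t *\<^sub>R (1, 1) - h) \<bullet> \<xi>"
    by (auto simp: eventually_at_filter elim: eventually_mono dest: eventually_nhds_x_imp_x)
  then show ?thesis
    using has_derivative_transform_eventually[of "\<lambda>\<zeta>. (t *\<^sub>R (1, 1) - h) \<bullet> \<zeta>" "\<lambda>u. (t *\<^sub>R (1, 1) - h) \<bullet> u" \<xi> UNIV "gpp P"]
    by (simp add: eq_commute bounded_linear_inner_right bounded_linear_imp_has_derivative)
qed

end

section \<open>Stationary cocycles\<close>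

text \<open>Sites are pairs; splitting quantified sites into coordinates would hide the cocycle
  identities from the simplifier.\<close>

declare split_paired_All [simp del] split_paired_Ex [simp del]

lemma rvec_add: "rvec (x + y) = rvec x + rvec y"
  by (simp add: rvec_def)

lemma rvec_diff: "rvec (x - y) = rvec x - rvec y"
  by (simp add: rvec_def)

lemma rvec_minus: "rvec (- x) = - rvec x"
  by (simp add: rvec_def)

lemma rvec_0 [simp]: "rvec 0 = 0"
  by (simp add: rvec_def zero_prod_def)

text \<open>Stationarity of a cocycle is exploited both on the environment space and on the extended space;
  this locale is their common setting.\<close>

locale measure_preserving_shifts = prob_space M for M :: "'w measure" +
  fixes \<tau> :: "site \<Rightarrow> 'w \<Rightarrow> 'w"
  assumes measurable_shift [measurable]: "\<And>z. \<tau> z \<in> measurable M M"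
    and distr_shift: "\<And>z. distr M M (\<tau> z) = M"
begin

lemma AE_shift: "AE w in M. Q w \<Longrightarrow> AE w in M. Q (\<tau> z w)"
  by (rule AE_distrD[OF measurable_shift]) (simp only: distr_shift)

lemma integrable_shift: "integrable M f \<Longrightarrow> integrable M (\<lambda>w. f (\<tau> z w))"
  for f :: "'w \<Rightarrow> real"
  by (rule integrable_distr[OF measurable_shift]) (simp only: distr_shift)

lemma integral_shift: "f \<in> borel_measurable M \<Longrightarrow> (\<integral>w. f (\<tau> z w) \<partial>M) = (\<integral>w. f w \<partial>M)"
  for f :: "'w \<Rightarrow> real"
  using integral_distr[OF measurable_shift[of z], of f] by (simp add: distr_shift)

context
  fixes B :: "'w cocycle"
  assumes B: "stat_cocycle M \<tau> B"
begin

lemma cocycle_measurable [measurable]: "(\<lambda>w. B w x y) \<in> borel_measurable M"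
  using B by (simp add: stat_cocycle_def)

lemma cocycle_additive: "AE w in M. \<forall>x y z. B w x y + B w y z = B w x z"
  using B unfolding stat_cocycle_def by (auto elim!: eventually_mono)

lemma cocycle_stationary: "AE w in M. \<forall>x y z. B w (z + x) (z + y) = B (\<tau> z w) x y"
  using B unfolding stat_cocycle_def by (auto elim!: eventually_mono)

lemma cocycle_integrable_mean_shift:
  assumes "integrable M (\<lambda>w. B w 0 v)"
  shows "integrable M (\<lambda>w. B w x (x + v))" "(\<integral>w. B w x (x + v) \<partial>M) = (\<integral>w. B w 0 v \<partial>M)"
proof -
  have *: "AE w in M. B (\<tau> x w) 0 v = B w x (x + v)"
    using cocycle_stationary by eventually_elim (metis add.right_neutral)
  show "integrable M (\<lambda>w. B w x (x + v))"
    using integrable_shift[OF assms, of x] by (rule integrable_cong_AE_imp[OF _ _ *]) measurable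
  show "(\<integral>w. B w x (x + v) \<partial>M) = (\<integral>w. B w 0 v \<partial>M)"
    using integral_cong_AE[OF _ _ *] integral_shift[of "\<lambda>w. B w 0 v" x] by simp
qed

text \<open>The means of \<open>B 0 v\<close> are additive in \<open>v\<close> by stationarity and the cocycle property, so they
  are determined by their values on the two generators of the lattice.\<close>

lemma cocycle_integrable_mean:
  "integrable M (\<lambda>w. B w x y) \<and> (\<integral>w. B w x y \<partial>M) = hvec M B \<bullet> rvec (x - y)"
proof -
  \<comment> \<open>The displacements with this property form a subgroup that contains both unit steps.\<close>
  define good where "good v \<longleftrightarrow> integrable M (\<lambda>w. B w 0 v) \<and> (\<integral>w. B w 0 v \<partial>M) = - (hvec M B \<bullet> rvec v)" for v
  have add: "good (u + v)" if "good u" "good v" for u v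
  proof -
    have *: "AE w in M. B w 0 u + B w u (u + v) = B w 0 (u + v)"
      using cocycle_additive by eventually_elim metis
    have int: "integrable M (\<lambda>w. B w 0 u)" "integrable M (\<lambda>w. B w u (u + v))"
      using that cocycle_integrable_mean_shift(1)[of v u] by (auto simp: good_def)
    have "integrable M (\<lambda>w. B w 0 (u + v))"
      by (rule integrable_cong_AE_imp[OF Bochner_Integration.integrable_add[OF int] _ *]) measurable
    moreover have "(\<integral>w. B w 0 (u + v) \<partial>M) = (\<integral>w. B w 0 u + B w u (u + v) \<partial>M)"
      by (rule integral_cong_AE[OF _ _ AE_symmetric[OF *]]) measurable
    ultimately show ?thesis
      using that int cocycle_integrable_mean_shift(2)[of v u] by (simp add: good_def rvec_add inner_add_right)
  qed
  have neg: "good (- v)" if "good v" for v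
  proof -
    have *: "AE w in M. - B w (- v) (- v + v) = B w 0 (- v)"
      using cocycle_additive by eventually_elim (smt (verit) add.left_inverse)
    have int: "integrable M (\<lambda>w. B w (- v) (- v + v))"
      using that cocycle_integrable_mean_shift(1)[of v "- v"] by (auto simp: good_def)
    have "integrable M (\<lambda>w. B w 0 (- v))"
      by (rule integrable_cong_AE_imp[OF Bochner_Integration.integrable_minus[OF int] _ *]) measurable
    moreover have "(\<integral>w. B w 0 (- v) \<partial>M) = (\<integral>w. - B w (- v) (- v + v) \<partial>M)"
      by (rule integral_cong_AE[OF _ _ AE_symmetric[OF *]]) measurable
    ultimately show ?thesis
      using that int cocycle_integrable_mean_shift(2)[of v "- v"] by (simp add: good_def rvec_minus)
  qed
  have "good (e 1)" "good (e 2)"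
    using B by (simp_all add: good_def stat_cocycle_def hvec_def)
  then have g: "good (1, 0)" "good (0, 1)" by (simp_all add: e_def)
  have "good 0" using add[OF g(1) neg[OF g(1)]] by (simp add: zero_prod_def)
  then have z: "good (0, 0)" by (simp add: zero_prod_def)
  have 1: "good (a, 0)" for a
  proof (induction a rule: int_induct[where k = 0])
    case (step1 a) then show ?case using add[OF _ g(1), of "(a, 0)"] by simp
  next
    case (step2 a) then show ?case using add[OF _ neg[OF g(1)], of "(a, 0)"] by simp
  qed (rule z)
  have 2: "good (0, b)" for b
  proof (induction b rule: int_induct[where k = 0])
    case (step1 b) then show ?case using add[OF _ g(2), of "(0, b)"] by simp
  next
    case (step2 b) then show ?case using add[OF _ neg[OF g(2)], of "(0, b)"] by simp
  qed (rule z)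
  have "good v" for v using add[OF 1 2, of "fst v" "snd v"] by simp
  then show ?thesis
    using cocycle_integrable_mean_shift[of "y - x" x] by (simp add: good_def rvec_diff inner_diff_right)
qed

lemmas cocycle_integrable = cocycle_integrable_mean[THEN conjunct1]

lemma stat_cocycle_centered: "stat_cocycle M \<tau> (centered M B)"
  unfolding stat_cocycle_def
proof (intro conjI allI ballI)
  show "integrable M (\<lambda>w. centered M B w 0 (e i))" for i
    using cocycle_integrable by (simp add: centered_def)
  show "AE w in M. \<forall>x y z. centered M B w (z + x) (z + y) = centered M B (\<tau> z w) x y \<and>
      centered M B w x y + centered M B w y z = centered M B w x z"
    using cocycle_additive cocycle_stationary
  proof eventually_elim
    case (elim w)
    show ?case
    proof (intro allI conjI)
      show "centered M B w (z + x) (z + y) = centered M B (\<tau> z w) x y" for x y z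
        using elim(2) by (simp add: centered_def)
      show "centered M B w x y + centered M B w y z = centered M B w x z" for x y z
        using elim(1)[rule_format, of x y z] by (simp add: centered_def rvec_diff inner_diff_right)
    qed
  qed
qed (simp add: centered_def)

lemma centered_mean: "(\<integral>w. centered M B w x y \<partial>M) = 0"
  using cocycle_integrable_mean[of x y] by (simp add: centered_def prob_space)

end

lemma stat_cocycle_mix:
  assumes F: "stat_cocycle M \<tau> F" and F': "stat_cocycle M \<tau> F'"
  shows "stat_cocycle M \<tau> (mix \<theta> F F')"
  unfolding stat_cocycle_def
proof (intro conjI allI ballI)
  note [measurable] = cocycle_measurable[OF F] cocycle_measurable[OF F']
  show "(\<lambda>w. mix \<theta> F F' w x y) \<in> borel_measurable M" for x y
    unfolding mix_def by measurable
  show "integrable M (\<lambda>w. mix \<theta> F F' w 0 (e i))" for i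
    using cocycle_integrable[OF F] cocycle_integrable[OF F'] by (simp add: mix_def)
  show "AE w in M. \<forall>x y z. mix \<theta> F F' w (z + x) (z + y) = mix \<theta> F F' (\<tau> z w) x y \<and>
      mix \<theta> F F' w x y + mix \<theta> F F' w y z = mix \<theta> F F' w x z"
    using cocycle_additive[OF F] cocycle_additive[OF F'] cocycle_stationary[OF F] cocycle_stationary[OF F']
  proof eventually_elim
    case (elim w)
    show ?case
    proof (intro allI conjI)
      fix x y z
      show "mix \<theta> F F' w (z + x) (z + y) = mix \<theta> F F' (\<tau> z w) x y"
        using elim(3,4) by (simp add: mix_def)
      have "mix \<theta> F F' w x y + mix \<theta> F F' w y z
          = \<theta> * (F w x y + F w y z) + (1 - \<theta>) * (F' w x y + F' w y z)"
        by (simp add: mix_def algebra_simps)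
      also have "\<dots> = mix \<theta> F F' w x z"
        unfolding elim(1)[rule_format] elim(2)[rule_format] by (simp add: mix_def)
      finally show "mix \<theta> F F' w x y + mix \<theta> F F' w y z = mix \<theta> F F' w x z" .
    qed
  qed
qed

end

lemma step_max_le_iff: "step_max h \<omega> F \<le> r \<longleftrightarrow> (\<forall>i\<in>{1, 2}. \<omega> 0 + h \<bullet> rvec (e i) + F 0 (e i) \<le> r)"
  unfolding step_max_def by (subst Max_le_iff) auto

lemma step_max_eq_max:
  "step_max h \<omega> F = max (\<omega> 0 + h \<bullet> rvec (e 1) + F 0 (e 1)) (\<omega> 0 + h \<bullet> rvec (e 2) + F 0 (e 2))"
  by (simp add: step_max_def)

section \<open>The cocycle family as a measure-preserving system\<close>

context cocycle_family
begin

lemma measurable_fst_Ph [measurable]: "fst \<in> measurable Ph P"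
  unfolding measurable_cong_sets[OF sets_Ph sets_P] Omega_hat_def by simp

lemma measurable_T [measurable]: "T z \<in> measurable P P"
  unfolding measurable_cong_sets[OF sets_P sets_P] Omega_def T_def
  by (rule measurable_PiM_single') (auto simp: space_PiM)

lemma measurable_T_hat [measurable]: "T_hat z \<in> measurable Ph Ph"
proof -
  let ?I = "{1, 2 :: nat} \<times> A0 \<times> (UNIV :: site set)"
  let ?A = "PiM ?I (\<lambda>_. borel :: real measure)"
  have "(\<lambda>w. T z (fst w)) \<in> measurable (Omega \<Otimes>\<^sub>M ?A) Omega"
    using measurable_compose[OF measurable_fst measurable_T[unfolded measurable_cong_sets[OF sets_P sets_P]]] .
  moreover have "(\<lambda>w (i, a, x). snd w (i, a, z + x)) \<in> measurable (Omega \<Otimes>\<^sub>M ?A) ?A"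
  proof (rule measurable_PiM_single')
    fix k assume "k \<in> ?I"
    then obtain i a x where k: "k = (i, a, x)" "(i, a, z + x) \<in> ?I" by auto
    show "(\<lambda>w. (case k of (i, a, x) \<Rightarrow> snd w (i, a, z + x))) \<in> borel_measurable (Omega \<Otimes>\<^sub>M ?A)"
      unfolding k(1) prod.case
      using measurable_compose[OF measurable_snd measurable_component_singleton[OF k(2)]] .
  next
    show "(\<lambda>w (i, a, x). snd w (i, a, z + x)) \<in> space (Omega \<Otimes>\<^sub>M ?A) \<rightarrow> (\<Pi>\<^sub>E k\<in>?I. space borel)"
    proof
      fix w assume "w \<in> space (Omega \<Otimes>\<^sub>M ?A)"
      then have "snd w \<in> extensional ?I"
        by (auto simp: space_pair_measure space_PiM PiE_def)
      then show "(\<lambda>(i, a, x). snd w (i, a, z + x)) \<in> (\<Pi>\<^sub>E k\<in>?I. space borel)"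
        by (cases z) (simp add: PiE_def extensional_def split_paired_All)
    qed
  qed
  ultimately show ?thesis
    unfolding measurable_cong_sets[OF sets_Ph sets_Ph] Omega_hat_def T_hat_def by (rule measurable_Pair)
qed

lemma fst_T_hat: "fst (T_hat z w) = T z (fst w)"
  by (simp add: T_hat_def)

text \<open>Invariance of the environment law descends from that of the extended law, because the projection
  intertwines the two shifts.\<close>

lemma distr_T: "distr P P (T z) = P"
proof -
  have "distr P P (T z) = distr (distr Ph P fst) P (T z)" by (simp only: marginal)
  also have "\<dots> = distr Ph P (fst \<circ> T_hat z)"
    by (subst distr_distr) (auto simp: comp_def fst_T_hat)
  also have "\<dots> = distr (distr Ph Ph (T_hat z)) P fst"
    by (subst distr_distr) auto
  finally show ?thesis by (simp only: invariant marginal)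
qed

sublocale env: measure_preserving_shifts P T
  by unfold_locales (auto simp: distr_T)

sublocale aux: measure_preserving_shifts Ph T_hat
  by unfold_locales (auto simp: invariant)

lemma AE_env_iff: "{\<omega> \<in> space P. Q \<omega>} \<in> sets P \<Longrightarrow> (AE w in Ph. Q (fst w)) \<longleftrightarrow> (AE \<omega> in P. Q \<omega>)"
  using AE_distr_iff[OF measurable_fst_Ph, of Q] by (simp only: marginal)

lemma integrable_env_iff: "f \<in> borel_measurable P \<Longrightarrow> integrable Ph (\<lambda>w. f (fst w)) \<longleftrightarrow> integrable P f"
  for f :: "env \<Rightarrow> real"
  using integrable_distr_eq[OF measurable_fst_Ph, of f] by (simp only: marginal)

lemma integral_env: "f \<in> borel_measurable P \<Longrightarrow> (\<integral>w. f (fst w) \<partial>Ph) = (\<integral>\<omega>. f \<omega> \<partial>P)"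
  for f :: "env \<Rightarrow> real"
  using integral_distr[OF measurable_fst_Ph, of f] by (simp only: marginal)

end

section \<open>The lower bound in the variational formula\<close>

text \<open>Along a path the cocycle telescopes, so the local bounds add up.\<close>

lemma passage_time_le_cocycle:
  assumes F: "\<And>x y z. F (z + x) (z + y) = F' z x y" "\<And>x y z. F x y + F y z = F x z"
    and step: "\<And>z. step_max h (T z \<omega>) (F' z) \<le> r" and x: "0 \<le> x"
  shows "G \<omega> 0 x \<le> real_of_int (level x) * r - h \<bullet> rvec x - F 0 x"
proof -
  have sum: "(\<Sum>k<n. \<omega> (p k)) \<le> real n * r - h \<bullet> rvec (p n) - F 0 (p n)"
    if "up_right n p" "p 0 = 0" for n p
    using that
  proof (induction n)
    case 0
    have "F 0 0 = 0" using F(2)[of 0 0 0] by simp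
    with 0 show ?case by simp
  next
    case (Suc n)
    then obtain i :: nat where i: "i \<in> {1, 2}" "p (Suc n) = p n + e i" by (auto simp: up_right_Suc)
    have "\<omega> (p n) + h \<bullet> rvec (e i) + F (p n) (p n + e i) \<le> r"
      using step[of "p n"] i(1) F(1)[of "p n" 0 "e i"] unfolding step_max_le_iff by (auto simp: T_def)
    with Suc i F(2)[of 0 "p n" "p n + e i"] show ?case
      by (auto simp: up_right_Suc rvec_add inner_add_right algebra_simps)
  qed
  from G_attained[OF x] obtain n p where p: "up_right n p" "p 0 = 0" "p n = x"
    "G \<omega> 0 x = (\<Sum>k<n. \<omega> (p k))" "level x = level 0 + int n" .
  from sum[OF p(1,2)] show ?thesis using p by (simp add: level_def)
qed

context cocycle_family
begin

text \<open>The mean of the telescoped bound at a deterministic endpoint is explicit because \<open>F\<close> has mean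
  zero. The passage times are bounded below by a multiple of the level, so Fatou's lemma passes
  from the means of the bounding variables to their almost sure lower limit.\<close>

lemma gpp_le_step_bound:
  assumes F: "F \<in> K0 P" and r: "AE \<omega> in P. step_max h \<omega> (F \<omega>) \<le> r" and \<xi>: "\<xi> \<in> riU"
  shows "gpp P \<xi> + h \<bullet> \<xi> \<le> r"
proof -
  have coc: "stat_cocycle P T F" and mean0: "\<And>x y. (\<integral>\<omega>. F \<omega> x y \<partial>P) = 0"
    using F by (auto simp: K0_def K_def)
  note [measurable] = env.cocycle_measurable[OF coc]
  obtain c where c: "c \<le> 0" "AE \<omega> in P. \<forall>x. c \<le> \<omega> x" using weights_bounded_below .
  define x where "x n = floor_vec (real n *\<^sub>R \<xi>)" for n
  \<comment> \<open>The telescoped upper bound for \<open>G 0 x\<^sub>n / n\<close>, shifted by the lower bound \<open>c\<close> of the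
    weights so as to be nonnegative.\<close>
  define Y where "Y n \<omega> = (real_of_int (level (x n)) * r - h \<bullet> rvec (x n) - F \<omega> 0 (x n)) / real n - c" for n \<omega>
  have x0: "0 \<le> x n" for n
    using \<xi> by (auto simp: x_def floor_vec_def less_eq_prod_def riU_iff)
  have xn: "level (x n) \<le> int n" for n
  proof -
    have "real n * fst \<xi> + real n * snd \<xi> = real n"
      using \<xi> by (simp add: riU_iff flip: distrib_left)
    then show ?thesis unfolding level_def x_def floor_vec_def by simp linarith
  qed
  have \<xi>0: "0 \<le> \<xi>" using \<xi> by (simp add: riU_iff less_eq_prod_def)
  have "AE \<omega> in P. \<forall>z. step_max h (T z \<omega>) (F (T z \<omega>)) \<le> r"
    using env.AE_shift[OF r] by (simp add: AE_all_countable)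
  with env.cocycle_additive[OF coc] env.cocycle_stationary[OF coc] c(2)
  have bounds: "AE \<omega> in P. \<forall>n>0. 0 \<le> G \<omega> 0 (x n) / real n - c \<and> G \<omega> 0 (x n) / real n - c \<le> Y n \<omega>"
  proof eventually_elim
    case (elim \<omega>)
    show ?case
    proof (intro allI impI conjI)
      fix n :: nat assume n: "0 < n"
      from G_attained[OF x0] obtain m p where p: "G \<omega> 0 (x n) = (\<Sum>k<m. \<omega> (p k))" "level (x n) = level 0 + int m"
        by metis
      have "real m \<le> real n" using p(2) xn[of n] by (simp add: level_def)
      then have "real n * c \<le> real m * c" using c(1) by (rule mult_right_mono_neg)
      also have "\<dots> = (\<Sum>k<m. c)" by simp
      also have "\<dots> \<le> G \<omega> 0 (x n)"
        unfolding p(1) using elim(3) by (intro sum_mono) auto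
      finally show "0 \<le> G \<omega> 0 (x n) / real n - c"
        using n by (simp add: field_simps)
      show "G \<omega> 0 (x n) / real n - c \<le> Y n \<omega>"
        unfolding Y_def using elim x0 n
        by (intro diff_right_mono divide_right_mono passage_time_le_cocycle[where F' = "\<lambda>z. F (T z \<omega>)"]) auto
    qed
  qed
  then have Y_nonneg: "AE \<omega> in P. \<forall>n>0. 0 \<le> Y n \<omega>"
    by eventually_elim (metis order_trans)
  have Y_int: "integrable P (Y n)" for n
    unfolding Y_def using env.cocycle_integrable[OF coc] by simp
  define y where "y n = (real_of_int (level (x n)) * r - h \<bullet> rvec (x n)) / real n - c" for n
  have Y_mean: "(\<integral>\<omega>. Y n \<omega> \<partial>P) = y n" for n
    unfolding Y_def y_def using env.cocycle_integrable[OF coc] mean0 prob_space by simp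
  have y_lim: "y \<longlonglongrightarrow> r - h \<bullet> \<xi> - c"
  proof -
    have "(\<lambda>n. r * ((1, 1) \<bullet> rvec (x n) / real n) - h \<bullet> rvec (x n) / real n - c)
        \<longlonglongrightarrow> r * ((1, 1) \<bullet> \<xi>) - h \<bullet> \<xi> - c"
      unfolding x_def by (intro tendsto_intros inner_floor_vec_tendsto)
    moreover have "(1, 1) \<bullet> \<xi> = 1" using \<xi> by (simp add: riU_iff inner_prod_def)
    moreover have "(1, 1) \<bullet> rvec (x n) = real_of_int (level (x n))" for n
      by (simp add: rvec_def level_def inner_prod_def)
    ultimately show ?thesis
      unfolding y_def by (simp add: diff_divide_distrib mult.commute)
  qed
  have nonneg: "0 \<le> y n" if "0 < n" for n
    unfolding Y_mean[symmetric]
    by (rule integral_nonneg_AE) (use Y_nonneg that in \<open>auto elim!: eventually_mono\<close>)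
  \<comment> \<open>Fatou's lemma for the nonnegative variables \<open>Y\<^sub>n\<close>, whose expectations are explicit
    because \<open>F\<close> has mean zero.\<close>
  have "ennreal (gpp P \<xi> - c) = (\<integral>\<^sup>+\<omega>. ennreal (gpp P \<xi> - c) \<partial>P)"
    using emeasure_space_1 by simp
  also have "\<dots> \<le> (\<integral>\<^sup>+\<omega>. liminf (\<lambda>n. ennreal (Y n \<omega>)) \<partial>P)"
  proof (rule nn_integral_mono_AE)
    show "AE \<omega> in P. ennreal (gpp P \<xi> - c) \<le> liminf (\<lambda>n. ennreal (Y n \<omega>))"
      using bounds gpp_tendsto[OF \<xi>0]
    proof eventually_elim
      case (elim \<omega>)
      have "(\<lambda>n. ennreal (G \<omega> 0 (x n) / real n - c)) \<longlonglongrightarrow> ennreal (gpp P \<xi> - c)"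
        unfolding x_def by (intro tendsto_ennrealI tendsto_intros elim)
      then have "ennreal (gpp P \<xi> - c) = liminf (\<lambda>n. ennreal (G \<omega> 0 (x n) / real n - c))"
        by (simp add: lim_imp_Liminf)
      also have "\<dots> \<le> liminf (\<lambda>n. ennreal (Y n \<omega>))"
        by (rule Liminf_mono, rule eventually_mono[OF eventually_gt_at_top[of 0]])
          (use elim(1) in \<open>auto intro: ennreal_leI\<close>)
      finally show ?case .
    qed
  qed
  also have "\<dots> \<le> liminf (\<lambda>n. \<integral>\<^sup>+\<omega>. ennreal (Y n \<omega>) \<partial>P)"
    using Y_int by (intro nn_integral_liminf) auto
  also have "\<dots> = liminf (\<lambda>n. ennreal (y n))"
  proof (rule Liminf_eq, rule eventually_mono[OF eventually_gt_at_top[of 0]])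
    fix n :: nat assume n: "0 < n"
    have "AE \<omega> in P. 0 \<le> Y n \<omega>"
      using Y_nonneg by (rule eventually_mono) (use n in auto)
    then show "(\<integral>\<^sup>+\<omega>. ennreal (Y n \<omega>) \<partial>P) = ennreal (y n)"
      using nn_integral_eq_integral[OF Y_int] by (simp add: Y_mean)
  qed
  also have "\<dots> = ennreal (r - h \<bullet> \<xi> - c)"
    using y_lim by (intro lim_imp_Liminf tendsto_ennrealI) auto
  finally have "ennreal (gpp P \<xi> - c) \<le> ennreal (r - h \<bullet> \<xi> - c)" .
  moreover have "0 \<le> r - h \<bullet> \<xi> - c"
    using y_lim by (rule tendsto_lowerbound)
      (auto intro!: eventually_mono[OF eventually_gt_at_top[of 0]] nonneg)
  ultimately show ?thesis by simp
qed

end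

section \<open>Conditioning on the environment\<close>

text \<open>The factorization (Doob and Dynkin) of a function that is measurable for the sigma-algebra
  generated by \<open>g\<close>. It is proved for nonnegative functions by measure-theoretic induction; the real
  case follows from positive and negative parts.\<close>

lemma ennreal_factors_through:
  fixes f :: "'a \<Rightarrow> ennreal"
  assumes f: "f \<in> borel_measurable (vimage_algebra X g N)" and g: "g \<in> X \<rightarrow> space N"
  shows "\<exists>k\<in>borel_measurable N. \<forall>x\<in>X. f x = k (g x)"
  using f
proof (induction rule: borel_measurable_induct)
  case (cong f f')
  then show ?case by simp
next
  case (set A)
  then obtain A' where "A' \<in> sets N" "A = g -` A' \<inter> X"
    using sets_vimage_algebra2[OF g] by auto
  then show ?case
    by (intro bexI[of _ "indicator A'"]) (auto simp: indicator_def)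
next
  case (mult u c)
  then obtain k where "k \<in> borel_measurable N" "\<forall>x\<in>X. u x = k (g x)" by blast
  then show ?case by (intro bexI[of _ "\<lambda>y. c * k y"]) auto
next
  case (add u v)
  then obtain k l where "k \<in> borel_measurable N" "\<forall>x\<in>X. u x = k (g x)"
    "l \<in> borel_measurable N" "\<forall>x\<in>X. v x = l (g x)" by blast
  then show ?case by (intro bexI[of _ "\<lambda>y. l y + k y"]) auto
next
  case (seq U)
  then obtain k where k: "\<And>i. k i \<in> borel_measurable N" "\<And>i x. x \<in> X \<Longrightarrow> U i x = k i (g x)"
    by metis
  then show ?case
    by (intro bexI[of _ "\<lambda>y. SUP i. k i y"]) (auto simp: image_image)
qed

lemma real_factors_through:
  fixes f :: "'a \<Rightarrow> real"
  assumes f [measurable]: "f \<in> borel_measurable (vimage_algebra X g N)" and g: "g \<in> X \<rightarrow> space N"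
  obtains k where "k \<in> borel_measurable N" "\<And>x. x \<in> X \<Longrightarrow> f x = k (g x)"
proof -
  obtain k l where kl: "k \<in> borel_measurable N" "\<forall>x\<in>X. ennreal (f x) = k (g x)"
    "l \<in> borel_measurable N" "\<forall>x\<in>X. ennreal (- f x) = l (g x)"
    using ennreal_factors_through[OF _ g, of "\<lambda>x. ennreal (f x)"]
      ennreal_factors_through[OF _ g, of "\<lambda>x. ennreal (- f x)"] by auto
  have "f x = enn2real (k (g x)) - enn2real (l (g x))" if "x \<in> X" for x
  proof -
    have "f x = enn2real (ennreal (f x)) - enn2real (ennreal (- f x))"
      by (cases "0 \<le> f x") (auto simp: ennreal_neg)
    with kl(2,4) that show ?thesis by simp
  qed
  then show ?thesis
    using kl(1,3) by (intro that[of "\<lambda>y. enn2real (k y) - enn2real (l y)"]) auto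
qed

context cocycle_family
begin

lemma subalgebra_env: "subalgebra Ph (env_algebra P Ph)"
  using measurable_fst_Ph by (auto simp: subalgebra_def env_algebra_def measurable_iff_sets)

sublocale ce: finite_measure_subalgebra Ph "env_algebra P Ph"
  by unfold_locales (rule subalgebra_env)

abbreviation env_cond_exp :: "(env \<times> aux \<Rightarrow> real) \<Rightarrow> env \<times> aux \<Rightarrow> real" where
  "env_cond_exp \<equiv> real_cond_exp Ph (env_algebra P Ph)"

lemma measurable_env_algebra: "f \<in> borel_measurable P \<Longrightarrow> (\<lambda>w. f (fst w)) \<in> borel_measurable (env_algebra P Ph)"
  unfolding env_algebra_def
  by (rule measurable_compose[OF measurable_vimage_algebra1]) auto

text \<open>A conditional expectation given the environment is a function on the extended space; the
  factorization turns it into a function on the environment space.\<close>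

lemma cond_version_exists: "\<exists>C. cond_version P Ph F C"
proof -
  have "\<exists>k. k \<in> borel_measurable P \<and> (\<forall>w\<in>space Ph. env_cond_exp (\<lambda>w. F w x y) w = k (fst w))" for x y
  proof -
    have "env_cond_exp (\<lambda>w. F w x y) \<in> borel_measurable (vimage_algebra (space Ph) fst P)"
      using borel_measurable_cond_exp[of Ph "env_algebra P Ph"] by (simp add: env_algebra_def)
    from real_factors_through[OF this] show ?thesis by (metis Pi_I UNIV_I space_P)
  qed
  then obtain k where "\<And>x y. k x y \<in> borel_measurable P"
    "\<And>x y w. w \<in> space Ph \<Longrightarrow> env_cond_exp (\<lambda>w. F w x y) w = k x y (fst w)"
    by metis
  then have "cond_version P Ph F (\<lambda>\<omega> x y. k x y \<omega>)"
    unfolding cond_version_def by (auto intro!: AE_I2)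
  then show ?thesis by (rule exI[of _ "\<lambda>\<omega> x y. k x y \<omega>"])
qed

lemma integral_indicator_cond_exp:
  assumes f: "integrable Ph f" and A: "A \<in> sets P"
  shows "(\<integral>w. indicator A (fst w) * env_cond_exp f w \<partial>Ph) = (\<integral>w. indicator A (fst w) * f w \<partial>Ph)"
proof (rule ce.real_cond_exp_intg(2))
  have [measurable]: "(\<lambda>w. indicator A (fst w) :: real) \<in> borel_measurable Ph"
    using A by measurable
  show "integrable Ph (\<lambda>w. indicator A (fst w) * f w)"
  proof (rule Bochner_Integration.integrable_bound[OF f])
    show "(\<lambda>w. indicator A (fst w) * f w) \<in> borel_measurable Ph"
      using f by measurable
  qed (simp add: indicator_def)
  show "(\<lambda>w. indicator A (fst w) :: real) \<in> borel_measurable (env_algebra P Ph)"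
    using A by (intro measurable_env_algebra) simp
qed (use f in simp)

lemma T_uminus_T: "T (- z) (T z \<omega>) = \<omega>"
  by (simp add: T_def flip: add.assoc)

text \<open>Both sides integrate alike over every environment event: the shift preserves the extended law
  and maps environment events to environment events.\<close>

lemma cond_exp_shift:
  assumes f: "integrable Ph f" and k: "k \<in> borel_measurable P"
    and fk: "AE w in Ph. k (fst w) = env_cond_exp f w"
  shows "AE w in Ph. env_cond_exp (\<lambda>w. f (T_hat z w)) w = k (T z (fst w))"
proof (rule ce.real_cond_exp_charact)
  note [measurable] = k borel_measurable_integrable[OF f]
  have k_int: "integrable Ph (\<lambda>w. k (fst w))"
    by (rule integrable_cong_AE_imp[OF ce.real_cond_exp_int(1)[OF f] _ AE_symmetric[OF fk]]) measurable
  show "integrable Ph (\<lambda>w. f (T_hat z w))" "integrable Ph (\<lambda>w. k (T z (fst w)))"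
    using aux.integrable_shift[OF f, of z] aux.integrable_shift[OF k_int, of z] by (simp_all add: fst_T_hat)
  show "(\<lambda>w. k (T z (fst w))) \<in> borel_measurable (env_algebra P Ph)"
    by (rule measurable_env_algebra) measurable
  fix A assume "A \<in> sets (env_algebra P Ph)"
  then obtain A' where A' [measurable]: "A' \<in> sets P" and A: "A = fst -` A' \<inter> space Ph"
    using sets_vimage_algebra2[of fst "space Ph" P] by (auto simp: env_algebra_def)
  \<comment> \<open>The event \<open>A'\<close> carried along by the shift, so that membership can be read off after shifting.\<close>
  define A'' where "A'' = T (- z) -` A' \<inter> space P"
  have A'' [measurable]: "A'' \<in> sets P" unfolding A''_def by measurable
  have ind: "indicator A w = (indicator A'' (fst (T_hat z w)) :: real)" if "w \<in> space Ph" for w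
    using that by (simp add: A A''_def fst_T_hat indicator_def T_uminus_T)
  have "(\<integral>w\<in>A. f (T_hat z w) \<partial>Ph) = (\<integral>w. indicator A'' (fst (T_hat z w)) * f (T_hat z w) \<partial>Ph)"
    unfolding set_lebesgue_integral_def by (rule Bochner_Integration.integral_cong) (auto simp: ind)
  also have "\<dots> = (\<integral>w. indicator A'' (fst w) * f w \<partial>Ph)"
    by (rule aux.integral_shift) measurable
  also have "\<dots> = (\<integral>w. indicator A'' (fst w) * env_cond_exp f w \<partial>Ph)"
    by (rule integral_indicator_cond_exp[OF f A'', symmetric])
  also have "\<dots> = (\<integral>w. indicator A'' (fst w) * k (fst w) \<partial>Ph)"
    using fk by (intro integral_cong_AE) (auto elim!: eventually_mono)
  also have "\<dots> = (\<integral>w. indicator A'' (fst (T_hat z w)) * k (fst (T_hat z w)) \<partial>Ph)"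
    by (rule aux.integral_shift[symmetric]) measurable
  also have "\<dots> = (\<integral>w\<in>A. k (T z (fst w)) \<partial>Ph)"
    unfolding set_lebesgue_integral_def
    by (rule Bochner_Integration.integral_cong) (auto simp: ind fst_T_hat)
  finally show "(\<integral>w\<in>A. f (T_hat z w) \<partial>Ph) = (\<integral>w\<in>A. k (T z (fst w)) \<partial>Ph)" .
qed

lemma cond_version_in_K0:
  assumes F: "stat_cocycle Ph T_hat F" and mean0: "\<And>x y. (\<integral>w. F w x y \<partial>Ph) = 0"
    and C: "cond_version P Ph F C"
  shows "C \<in> K0 P"
proof -
  note [measurable] = aux.cocycle_measurable[OF F]
  note F_int = aux.cocycle_integrable[OF F]
  have C_meas [measurable]: "(\<lambda>\<omega>. C \<omega> x y) \<in> borel_measurable P" for x y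
    using C by (simp add: cond_version_def)
  have CF: "AE w in Ph. C (fst w) x y = env_cond_exp (\<lambda>w. F w x y) w" for x y
    using C by (simp add: cond_version_def)
  have C_int: "integrable P (\<lambda>\<omega>. C \<omega> x y)" for x y
    unfolding integrable_env_iff[OF C_meas, symmetric]
    by (rule integrable_cong_AE_imp[OF ce.real_cond_exp_int(1)[OF F_int] _ AE_symmetric[OF CF]]) measurable
  have C_mean: "(\<integral>\<omega>. C \<omega> x y \<partial>P) = 0" for x y
    unfolding integral_env[OF C_meas, symmetric]
    using integral_cong_AE[OF _ _ CF] ce.real_cond_exp_int(2)[OF F_int] mean0 by simp
  have add': "AE w in Ph. C (fst w) x y + C (fst w) y z = C (fst w) x z" for x y z
  proof -
    have "AE w in Ph. F w x y + F w y z = F w x z"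
      using aux.cocycle_additive[OF F] by eventually_elim blast
    then have "AE w in Ph. env_cond_exp (\<lambda>w. F w x y + F w y z) w = env_cond_exp (\<lambda>w. F w x z) w"
      by (rule ce.real_cond_exp_cong) measurable
    with ce.real_cond_exp_add[OF F_int F_int, of x y y z] CF[of x y] CF[of y z] CF[of x z]
    show ?thesis by eventually_elim simp
  qed
  have add: "AE \<omega> in P. C \<omega> x y + C \<omega> y z = C \<omega> x z" for x y z
    by (rule iffD1[OF AE_env_iff add']) measurable
  have shift': "AE w in Ph. C (fst w) (z + x) (z + y) = C (T z (fst w)) x y" for x y z
  proof -
    have "AE w in Ph. F w (z + x) (z + y) = F (T_hat z w) x y"
      using aux.cocycle_stationary[OF F] by eventually_elim blast
    then have "AE w in Ph. env_cond_exp (\<lambda>w. F w (z + x) (z + y)) w = env_cond_exp (\<lambda>w. F (T_hat z w) x y) w"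
      by (rule ce.real_cond_exp_cong) measurable
    with cond_exp_shift[OF F_int C_meas CF, of z x y] CF[of "z + x" "z + y"]
    show ?thesis by eventually_elim simp
  qed
  have [measurable]: "(\<lambda>\<omega>. C (T z \<omega>) x y) \<in> borel_measurable P" for x y z
    by (rule measurable_compose[OF measurable_T C_meas])
  have shift: "AE \<omega> in P. C \<omega> (z + x) (z + y) = C (T z \<omega>) x y" for x y z
    by (rule iffD1[OF AE_env_iff shift']) measurable
  have "AE \<omega> in P. \<forall>x y z. C \<omega> (z + x) (z + y) = C (T z \<omega>) x y \<and> C \<omega> x y + C \<omega> y z = C \<omega> x z"
    using add shift by (simp add: AE_all_countable)
  then show ?thesis
    unfolding K0_def K_def stat_cocycle_def mem_Collect_eq
    by (intro conjI allI ballI C_meas C_int C_mean)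
qed

lemma step_max_cond_version_le:
  assumes F: "stat_cocycle Ph T_hat F" and C: "cond_version P Ph F C"
    and r: "AE w in Ph. step_max h (fst w) (F w) \<le> r"
  shows "AE \<omega> in P. step_max h \<omega> (C \<omega>) \<le> r"
proof -
  note F_int = aux.cocycle_integrable[OF F]
  have C_meas [measurable]: "(\<lambda>\<omega>. C \<omega> x y) \<in> borel_measurable P" for x y
    using C by (simp add: cond_version_def)
  have *: "AE w in Ph. fst w 0 + h \<bullet> rvec (e i) + C (fst w) 0 (e i) \<le> r" if i: "i \<in> {1, 2}" for i
  proof -
    define b where "b w = r - h \<bullet> rvec (e i) - fst w 0" for w :: "env \<times> aux"
    have b: "integrable Ph b" "b \<in> borel_measurable (env_algebra P Ph)"
      unfolding b_def
      using integrable_env_iff[of "\<lambda>\<omega>. \<omega> 0"] integrable_weight measurable_env_algebra[of "\<lambda>\<omega>. \<omega> 0"]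
      by auto
    have "AE w in Ph. F w 0 (e i) \<le> b w"
      using r by eventually_elim (use i in \<open>auto simp: step_max_le_iff b_def\<close>)
    from ce.real_cond_exp_mono[OF this F_int b(1)] ce.real_cond_exp_F_meas[OF b]
    have "AE w in Ph. env_cond_exp (\<lambda>w. F w 0 (e i)) w \<le> b w"
      by eventually_elim simp
    moreover have "AE w in Ph. C (fst w) 0 (e i) = env_cond_exp (\<lambda>w. F w 0 (e i)) w"
      using C by (simp add: cond_version_def)
    ultimately show ?thesis by eventually_elim (simp add: b_def)
  qed
  have "AE w in Ph. step_max h (fst w) (C (fst w)) \<le> r"
    using *[of 1] *[of 2] by (simp add: step_max_le_iff)
  moreover have "{\<omega> \<in> space P. step_max h \<omega> (C \<omega>) \<le> r} \<in> sets P"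
    unfolding step_max_eq_max by measurable
  ultimately show ?thesis
    using AE_env_iff[of "\<lambda>\<omega>. step_max h \<omega> (C \<omega>) \<le> r"] by blast
qed

lemma ess_step_ge:
  assumes C: "C \<in> K0 P" and \<xi>: "\<xi> \<in> riU"
  shows "ereal (gpp P \<xi> + h \<bullet> \<xi>) \<le> ess_step P h C"
proof (rule ccontr)
  assume "\<not> ?thesis"
  then have "ess_step P h C < ereal (gpp P \<xi> + h \<bullet> \<xi>)" by simp
  from ereal_dense2[OF this] obtain r where r: "ess_step P h C < ereal r" "r < gpp P \<xi> + h \<bullet> \<xi>"
    by auto
  have "AE \<omega> in P. ereal (step_max h \<omega> (C \<omega>)) \<le> ess_step P h C"
    unfolding ess_step_def by (rule esssup_AE)
  then have "AE \<omega> in P. step_max h \<omega> (C \<omega>) \<le> r"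
    by eventually_elim (use r(1) in \<open>metis ereal_less_eq(3) less_imp_le order_trans\<close>)
  from gpp_le_step_bound[OF C this \<xi>] r(2) show False by simp
qed

text \<open>Conditioning preserves the upper bound \<open>t\<close>, and every element of \<open>K0 P\<close> obeys the lower
  bound \<open>t\<close>. The essential supremum on the extended space is squeezed between the two: a smaller
  bound there would pass to the conditional expectation.\<close>

lemma cond_exp_minimizer:
  assumes F: "stat_cocycle Ph T_hat F" and mean0: "\<And>x y. (\<integral>w. F w x y \<partial>Ph) = 0"
    and t: "AE w in Ph. step_max h (fst w) (F w) \<le> t"
    and \<xi>: "\<xi> \<in> riU" "gpp P \<xi> + h \<bullet> \<xi> = t" and gpl: "gpl P h = t"
  shows "cond_exp_minimizes P Ph h F" and "ess_step_hat Ph h F = ereal t"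
    and "\<And>C. cond_version P Ph F C \<Longrightarrow> ess_step P h C = ereal t"
proof -
  note [measurable] = aux.cocycle_measurable[OF F]
  have ge: "ereal t \<le> ess_step P h C" if "C \<in> K0 P" for C
    using ess_step_ge[OF that \<xi>(1), of h] \<xi>(2) by simp
  have le: "ess_step P h C \<le> ereal r"
    if C: "cond_version P Ph F C" and r: "AE w in Ph. step_max h (fst w) (F w) \<le> r" for C r
  proof -
    have [measurable]: "(\<lambda>\<omega>. C \<omega> x y) \<in> borel_measurable P" for x y
      using C by (simp add: cond_version_def)
    show ?thesis
      unfolding ess_step_def using step_max_cond_version_le[OF F C r]
      by (intro esssup_I) (auto simp: step_max_eq_max)
  qed
  show eq: "ess_step P h C = ereal t" if C: "cond_version P Ph F C" for C
    using le[OF C t] ge[OF cond_version_in_K0[OF F mean0 C]] by (rule antisym)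
  obtain C where C: "cond_version P Ph F C" using cond_version_exists by blast
  have inf: "(INF F'\<in>K0 P. ess_step P h F') = ereal t"
    using ge eq[OF C] cond_version_in_K0[OF F mean0 C]
    by (intro antisym INF_greatest) (auto intro: INF_lower2)
  show "cond_exp_minimizes P Ph h F"
    unfolding cond_exp_minimizes_def inf
    using C eq cond_version_in_K0[OF F mean0] gpl by auto
  show "ess_step_hat Ph h F = ereal t"
  proof (rule antisym)
    show "ess_step_hat Ph h F \<le> ereal t"
      unfolding ess_step_hat_def using t by (intro esssup_I) (auto simp: step_max_eq_max)
    show "ereal t \<le> ess_step_hat Ph h F"
    proof (rule ccontr)
      assume "\<not> ?thesis"
      then have "ess_step_hat Ph h F < ereal t" by simp
      from ereal_dense2[OF this] obtain r where r: "ess_step_hat Ph h F < ereal r" "r < t"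
        by auto
      have "AE w in Ph. ereal (step_max h (fst w) (F w)) \<le> ess_step_hat Ph h F"
        unfolding ess_step_hat_def by (rule esssup_AE)
      then have "AE w in Ph. step_max h (fst w) (F w) \<le> r"
        by eventually_elim (use r(1) in \<open>metis ereal_less_eq(3) less_imp_le order_trans\<close>)
      from le[OF C this] eq[OF C] r(2) show False by simp
    qed
  qed
qed

end

section \<open>Minimizers from the cocycle family\<close>

context cocycle_family
begin

lemma step_max_centered:
  "step_max h (fst w) (centered Ph (B s \<xi>) w) =
    fst w 0 + max ((h - hvec Ph (B s \<xi>)) \<bullet> (1, 0) - B s \<xi> w 0 (e 1)) ((h - hvec Ph (B s \<xi>)) \<bullet> (0, 1) - B s \<xi> w 0 (e 2))"
  by (simp add: step_max_eq_max centered_def rvec_minus inner_diff_left max_def)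

text \<open>Since \<open>\<omega>\<^sub>0\<close> lies below both one-sided cocycles in both directions, it lies below
  their convex combination. The minimum of the combination may exceed \<open>\<omega>\<^sub>0\<close>, because the two
  cocycles can attain their minima in different directions; hence only an inequality.\<close>

lemma mix_step_bound:
  assumes \<xi>: "\<xi> \<in> riU" and \<theta>: "\<theta> \<in> {0..1}"
    and h: "h - t *\<^sub>R (rvec (e 1) + rvec (e 2)) = \<theta> *\<^sub>R hvec Ph (B Minus \<xi>) + (1 - \<theta>) *\<^sub>R hvec Ph (B Plus \<xi>)"
  shows "AE w in Ph. step_max h (fst w) (mix \<theta> (centered Ph (B Minus \<xi>)) (centered Ph (B Plus \<xi>)) w) \<le> t"
  using recovery[OF \<xi>, of Minus] recovery[OF \<xi>, of Plus]
proof eventually_elim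
  case (elim w)
  show ?case
    unfolding step_max_le_iff
  proof
    fix i :: nat assume i: "i \<in> {1, 2}"
    have w: "fst w 0 \<le> B s \<xi> w 0 (e i)" for s
      using elim(1)[rule_format, of 0] elim(2)[rule_format, of 0] i by (cases s) auto
    have "fst w 0 = \<theta> * fst w 0 + (1 - \<theta>) * fst w 0" by (simp add: algebra_simps)
    also have "\<dots> \<le> \<theta> * B Minus \<xi> w 0 (e i) + (1 - \<theta>) * B Plus \<xi> w 0 (e i)"
      using \<theta> by (intro add_mono mult_left_mono w) auto
    finally have le: "fst w 0 \<le> \<theta> * B Minus \<xi> w 0 (e i) + (1 - \<theta>) * B Plus \<xi> w 0 (e i)" .
    have "(h - t *\<^sub>R (rvec (e 1) + rvec (e 2))) \<bullet> rvec (e i) = h \<bullet> rvec (e i) - t"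
      using i by (auto simp: inner_diff_left inner_prod_def)
    then have "h \<bullet> rvec (e i) - t = \<theta> * (hvec Ph (B Minus \<xi>) \<bullet> rvec (e i)) + (1 - \<theta>) * (hvec Ph (B Plus \<xi>) \<bullet> rvec (e i))"
      unfolding h by (simp add: inner_add_left)
    with le show "fst w 0 + h \<bullet> rvec (e i) + mix \<theta> (centered Ph (B Minus \<xi>)) (centered Ph (B Plus \<xi>)) w 0 (e i) \<le> t"
      by (simp add: mix_def centered_def rvec_minus algebra_simps)
  qed
qed

lemma centered_step_constant:
  assumes \<xi>: "\<xi> \<in> riU" and h: "h - t *\<^sub>R (rvec (e 1) + rvec (e 2)) = hvec Ph (B s \<xi>)"
  shows "AE w in Ph. step_max h (fst w) (centered Ph (B s \<xi>) w) = t"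
  using recovery[OF \<xi>, of s]
proof eventually_elim
  case (elim w)
  have "h - hvec Ph (B s \<xi>) = (t, t)" using h by (simp add: algebra_simps)
  with elim[rule_format, of 0] show ?case
    by (simp add: step_max_centered max_def min_def)
qed

context
  fixes h t \<xi>
  assumes dual: "dual_dir P h t \<xi>"
begin

lemma dual_dir_in_riU: "\<xi> \<in> riU"
  using dual by (simp add: dual_dir_def)

lemma mix_minimizer:
  assumes \<theta>: "\<theta> \<in> {0..1}"
    and h: "h - t *\<^sub>R (rvec (e 1) + rvec (e 2)) = \<theta> *\<^sub>R hvec Ph (B Minus \<xi>) + (1 - \<theta>) *\<^sub>R hvec Ph (B Plus \<xi>)"
  defines "F \<equiv> mix \<theta> (centered Ph (B Minus \<xi>)) (centered Ph (B Plus \<xi>))"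
  shows "cond_exp_minimizes P Ph h F" and "ess_step_hat Ph h F = ereal t"
    and "\<And>C. cond_version P Ph F C \<Longrightarrow> ess_step P h C = ereal t"
proof -
  note coc = cocycle[OF dual_dir_in_riU]
  note F = aux.stat_cocycle_mix[OF aux.stat_cocycle_centered[OF coc] aux.stat_cocycle_centered[OF coc],
      of \<theta> Minus Plus, folded F_def]
  have mean0: "(\<integral>w. F w x y \<partial>Ph) = 0" for x y
    unfolding F_def mix_def
    using aux.cocycle_integrable[OF aux.stat_cocycle_centered[OF coc]] aux.centered_mean[OF coc] by simp
  note step = mix_step_bound[OF dual_dir_in_riU \<theta> h, folded F_def]
  note min = cond_exp_minimizer[OF F mean0 step dual_dir_in_riU dual_dir_supporting_line(1)[OF dual] gpl_eq_dual[OF dual]]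
  show "cond_exp_minimizes P Ph h F" and "ess_step_hat Ph h F = ereal t"
    and "\<And>C. cond_version P Ph F C \<Longrightarrow> ess_step P h C = ereal t"
    by (fact min)+
qed

lemma centered_minimizer:
  assumes h: "h - t *\<^sub>R (rvec (e 1) + rvec (e 2)) = hvec Ph (B s \<xi>)"
  shows "constant_ae P Ph h t (centered Ph (B s \<xi>))"
    and "cond_exp_minimizes P Ph h (centered Ph (B s \<xi>))"
proof -
  show "constant_ae P Ph h t (centered Ph (B s \<xi>))"
    unfolding constant_ae_def gpl_eq_dual[OF dual]
    using centered_step_constant[OF dual_dir_in_riU h] by (rule eventually_mono) simp
  show "cond_exp_minimizes P Ph h (centered Ph (B s \<xi>))"
  proof (cases s)
    case Minus
    with mix_minimizer(1)[of 1] h show ?thesis by (simp add: mix_def)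
  next
    case Plus
    with mix_minimizer(1)[of 0] h show ?thesis by (simp add: mix_def)
  qed
qed

end

lemma dual_dir_hvec:
  assumes d: "dual_dir P h t \<xi>"
  obtains \<theta> where "\<theta> \<in> {0..1}"
    "h - t *\<^sub>R (rvec (e 1) + rvec (e 2)) = \<theta> *\<^sub>R hvec Ph (B Minus \<xi>) + (1 - \<theta>) *\<^sub>R hvec Ph (B Plus \<xi>)"
proof -
  from d obtain u where u: "0 \<le> u" "u \<le> 1"
    "h - t *\<^sub>R (rvec (e 1) + rvec (e 2)) = - ((1 - u) *\<^sub>R grad (gpp P) Plus \<xi> + u *\<^sub>R grad (gpp P) Minus \<xi>)"
    unfolding dual_dir_def closed_segment_def by blast
  with mean[OF dual_dir_in_riU[OF d]] show ?thesis
    by (intro that[of u]) (simp_all add: algebra_simps)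
qed

text \<open>At a point of differentiability the segment between the one-sided gradients degenerates.\<close>

lemma dual_dir_diff_hvec:
  assumes d: "dual_dir P h t \<xi>" and diff: "\<xi> \<in> diff_dirs P"
  shows "h - t *\<^sub>R (rvec (e 1) + rvec (e 2)) = hvec Ph (B s \<xi>)"
proof -
  obtain \<theta> where \<theta>: "h - t *\<^sub>R (rvec (e 1) + rvec (e 2)) = \<theta> *\<^sub>R hvec Ph (B Minus \<xi>) + (1 - \<theta>) *\<^sub>R hvec Ph (B Plus \<xi>)"
    using dual_dir_hvec[OF d] by blast
  have eq: "hvec Ph (B s' \<xi>) = hvec Ph (B s \<xi>)" for s'
    by (simp add: mean dual_dir_in_riU[OF d] grad_gpp_on_diff_dirs[OF diff, of s' s])
  show ?thesis
    unfolding \<theta> eq[of Minus] eq[of Plus] by (simp flip: scaleR_add_left)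
qed

lemma centered_eq_if_hvec_eq:
  assumes "\<xi> \<in> riU" "\<xi>' \<in> riU" "hvec Ph (B s \<xi>) = hvec Ph (B s' \<xi>')" "w \<in> space Ph"
  shows "centered Ph (B s \<xi>) w = centered Ph (B s' \<xi>') w"
  using equal_h[OF assms] by (simp add: centered_def assms(3))

lemma open_segment_diff_dirs:
  assumes "duality_data P h t \<xi>lo \<xi>hi" "\<xi> \<in> open_segment \<xi>lo \<xi>hi"
  shows "dual_dir P h t \<xi>" "\<xi> \<in> diff_dirs P"
proof -
  show d: "dual_dir P h t \<xi>"
    using assms by (auto simp: duality_data_def open_segment_def)
  show "\<xi> \<in> diff_dirs P"
    using gpp_linear_near_flat_segment[OF assms] dual_dir_in_riU[OF d]
    by (auto simp: diff_dirs_def differentiable_def)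
qed

end

theorem theorem5p6:
  fixes P :: "env measure" and Ph :: "(env \<times> aux) measure" and A0 :: "real set"
    and B :: "side \<Rightarrow> real \<times> real \<Rightarrow> (env \<times> aux) cocycle"
    and h \<xi>lo \<xi>hi :: "real \<times> real" and t :: real
  assumes "cocycle_family P Ph A0 B"
    and "duality_data P h t \<xi>lo \<xi>hi"
  shows
    "(\<xi>lo \<noteq> \<xi>hi \<longrightarrow>
        (\<forall>\<xi> \<in> open_segment \<xi>lo \<xi>hi. \<xi> \<in> diff_dirs P \<and>
           (\<forall>s. constant_ae P Ph h t (centered Ph (B s \<xi>)) \<and>
                cond_exp_minimizes P Ph h (centered Ph (B s \<xi>)))) \<and>
        (\<forall>\<xi> \<in> open_segment \<xi>lo \<xi>hi. \<forall>\<xi>' \<in> open_segment \<xi>lo \<xi>hi. \<forall>s s'. \<forall>w \<in> space Ph.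
           centered Ph (B s \<xi>) w = centered Ph (B s' \<xi>') w)) \<and>
     (\<forall>\<xi>. \<xi>lo = \<xi> \<and> \<xi>hi = \<xi> \<and> \<xi> \<in> diff_dirs P \<longrightarrow>
        (\<forall>s. constant_ae P Ph h t (centered Ph (B s \<xi>)) \<and>
             cond_exp_minimizes P Ph h (centered Ph (B s \<xi>))) \<and>
        (\<forall>w \<in> space Ph. centered Ph (B Minus \<xi>) w = centered Ph (B Plus \<xi>) w)) \<and>
     (\<forall>\<xi>. \<xi>lo = \<xi> \<and> \<xi>hi = \<xi> \<and> \<xi> \<notin> diff_dirs P \<longrightarrow>
        (\<exists>\<theta>\<in>{0..1}. h - t *\<^sub>R (rvec (e 1) + rvec (e 2)) =
             \<theta> *\<^sub>R hvec Ph (B Minus \<xi>) + (1 - \<theta>) *\<^sub>R hvec Ph (B Plus \<xi>)) \<and>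
        (\<forall>\<theta>\<in>{0..1}. h - t *\<^sub>R (rvec (e 1) + rvec (e 2)) =
             \<theta> *\<^sub>R hvec Ph (B Minus \<xi>) + (1 - \<theta>) *\<^sub>R hvec Ph (B Plus \<xi>) \<longrightarrow>
           (let F = mix \<theta> (centered Ph (B Minus \<xi>)) (centered Ph (B Plus \<xi>)) in
              (\<theta> \<in> {0, 1} \<longrightarrow> constant_ae P Ph h t F) \<and>
              (\<forall>C. cond_version P Ph F C \<longrightarrow> ereal (gpl P h) = ess_step P h C) \<and>
              ereal (gpl P h) = ess_step_hat Ph h F \<and> gpl P h = t \<and>
              cond_exp_minimizes P Ph h F)))"
proof -
  interpret cocycle_family P Ph A0 B by fact
  note dd = assms(2)
  have point: "dual_dir P h t \<xi>" if "\<xi>lo = \<xi>" "\<xi>hi = \<xi>" for \<xi>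
    using dd that by (auto simp: duality_data_def)
  show ?thesis
  proof (intro conjI impI allI ballI; (elim conjE)?)
    fix \<xi> s assume \<xi>: "\<xi> \<in> open_segment \<xi>lo \<xi>hi"
    note d = open_segment_diff_dirs[OF dd \<xi>]
    show "\<xi> \<in> diff_dirs P" by (rule d)
    show "constant_ae P Ph h t (centered Ph (B s \<xi>))" "cond_exp_minimizes P Ph h (centered Ph (B s \<xi>))"
      by (rule centered_minimizer[OF d(1) dual_dir_diff_hvec[OF d]])+
  next
    fix \<xi> \<xi>' s s' w
    assume \<xi>: "\<xi> \<in> open_segment \<xi>lo \<xi>hi" "\<xi>' \<in> open_segment \<xi>lo \<xi>hi" and w: "w \<in> space Ph"
    note d = open_segment_diff_dirs[OF dd \<xi>(1)] and d' = open_segment_diff_dirs[OF dd \<xi>(2)]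
    show "centered Ph (B s \<xi>) w = centered Ph (B s' \<xi>') w"
      using dual_dir_diff_hvec[OF d, of s] dual_dir_diff_hvec[OF d', of s'] w
      by (intro centered_eq_if_hvec_eq dual_dir_in_riU[OF d(1)] dual_dir_in_riU[OF d'(1)]) auto
  next
    fix \<xi> s assume \<xi>: "\<xi>lo = \<xi>" "\<xi>hi = \<xi>" and diff: "\<xi> \<in> diff_dirs P"
    note d = point[OF \<xi>] diff
    show "constant_ae P Ph h t (centered Ph (B s \<xi>))" "cond_exp_minimizes P Ph h (centered Ph (B s \<xi>))"
      by (rule centered_minimizer[OF d(1) dual_dir_diff_hvec[OF d]])+
    fix w assume "w \<in> space Ph"
    then show "centered Ph (B Minus \<xi>) w = centered Ph (B Plus \<xi>) w"
      using dual_dir_diff_hvec[OF d, of Minus] dual_dir_diff_hvec[OF d, of Plus]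
      by (intro centered_eq_if_hvec_eq dual_dir_in_riU[OF d(1)]) auto
  next
    fix \<xi> assume \<xi>: "\<xi>lo = \<xi>" "\<xi>hi = \<xi>"
    note d = point[OF \<xi>]
    show "\<exists>\<theta>\<in>{0..1}. h - t *\<^sub>R (rvec (e 1) + rvec (e 2)) =
        \<theta> *\<^sub>R hvec Ph (B Minus \<xi>) + (1 - \<theta>) *\<^sub>R hvec Ph (B Plus \<xi>)"
      using dual_dir_hvec[OF d] by blast
    fix \<theta> :: real
    assume \<theta>: "\<theta> \<in> {0..1}" and h: "h - t *\<^sub>R (rvec (e 1) + rvec (e 2)) =
        \<theta> *\<^sub>R hvec Ph (B Minus \<xi>) + (1 - \<theta>) *\<^sub>R hvec Ph (B Plus \<xi>)"
    define F where "F = mix \<theta> (centered Ph (B Minus \<xi>)) (centered Ph (B Plus \<xi>))"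
    note min = mix_minimizer[OF d \<theta> h, folded F_def]
    have "constant_ae P Ph h t F" if "\<theta> \<in> {0, 1}"
    proof (cases "\<theta> = 0")
      case True
      then have "F = centered Ph (B Plus \<xi>)" by (simp add: F_def mix_def)
      with centered_minimizer(1)[OF d, of Plus] h True show ?thesis by simp
    next
      case False
      with that have "\<theta> = 1" by simp
      then have "F = centered Ph (B Minus \<xi>)" by (simp add: F_def mix_def)
      with centered_minimizer(1)[OF d, of Minus] h \<open>\<theta> = 1\<close> show ?thesis by simp
    qed
    with min gpl_eq_dual[OF d]
    show "let F = mix \<theta> (centered Ph (B Minus \<xi>)) (centered Ph (B Plus \<xi>)) in
              (\<theta> \<in> {0, 1} \<longrightarrow> constant_ae P Ph h t F) \<and>
              (\<forall>C. cond_version P Ph F C \<longrightarrow> ereal (gpl P h) = ess_step P h C) \<and>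
              ereal (gpl P h) = ess_step_hat Ph h F \<and> gpl P h = t \<and>
              cond_exp_minimizes P Ph h F"
      unfolding F_def[symmetric] Let_def by auto
  qed
qed

end
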